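(* Almost all Kakeya sets sitting in $R^d$ have measure zero; that is, for almost every $f\in\Omega$ (with respect to the Haar probability measure on $\Omega$) one has $\mu(N(f))=0$.
   Context: $K$ is a field complete with respect to a discrete valuation $\mathrm{val}$ normalized by $\mathrm{val}(\pi)=1$ for a uniformizer $\pi$; $R$ is its ring of integers, $\mathfrak m=\pi R$ its maximal ideal, and the residue field $k=R/\mathfrak m$ is finite with $q$ elements. The norm is $|x|=q^{-\mathrm{val}(x)}$, and $d\ge 2$ is an integer. $K^d$ is equipped with $\|(x_1,\dots,x_d)\|_\infty=\max_i|x_i|$ and with the Haar measure $\mu$ normalized by $\mu(R^d)=1$. $\mathbb S^{d-1}(K)=\{x\in K^d:\|x\|_\infty=1\}$. $\mathbb P^{d-1}(K)$ is the set of lines through $0$ in $K^d$, identified with $\mathbb S^{d-1}(K)/R^\times$, with the distance $\mathrm{dist}(a,b)=\inf\|\hat a-\hat b\|_\infty$, the infimum being over all representatives $\hat a,\hat b\in\mathbb S^{d-1}(K)$ of $a$ and $b$. For $a\in\mathbb P^{d-1}(K)$, $\mathrm{can}(a)=(a_1,\dots,a_d)\in\mathbb S^{d-1}(K)$ is the unique representative of $a$ for which there is an index $j$ with $a_j=1$ and $|a_i|<1$ for all $i<j$. $\Omega$ is the set of $1$-Lipschitz functions $\mathbb P^{d-1}(K)\to R^d$. It is a group under pointwise addition, compact for the topology of uniform convergence, and is equipped with its Haar probability measure. For $f\in\Omega$ the associated (random) Kakeya set is $$N(f)=\bigcup_{a\in\mathbb P^{d-1}(K)}\{t\cdot\mathrm{can}(a)+f(a):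 t\in R\}\subset R^d.$$ *)

theory Defs
  imports "HOL-Analysis.Analysis" "HOL-Library.Function_Algebras"
begin

section \<open>Discretely valued fields\<close>

text \<open>
  A valuation is an integer-valued function \<open>v\<close> whose value at \<open>0\<close> is irrelevant:
  no definition below depends on \<open>v 0\<close>, which stands for \<open>\<infinity>\<close>.
\<close>

definition valuation_ring :: "('a::field \<Rightarrow> int) \<Rightarrow> 'a set" where
  "valuation_ring v = {x. x = 0 \<or> 0 \<le> v x}"

definition maximal_ideal :: "('a::field \<Rightarrow> int) \<Rightarrow> 'a set" where
  "maximal_ideal v = {x. x = 0 \<or> 1 \<le> v x}"

definition residue_field :: "('a::field \<Rightarrow> int) \<Rightarrow> 'a set set" where
  "residue_field v = valuation_ring v //
     {(x, y). x \<in> valuation_ring v \<and> y \<in> valuation_ring v \<and> x - y \<in> maximal_ideal v}"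

definition val_norm :: "('a::field \<Rightarrow> int) \<Rightarrow> 'a \<Rightarrow> real" where
  "val_norm v x = (if x = 0 then 0 else real (card (residue_field v)) powi (- v x))"

definition val_dist :: "('a::field \<Rightarrow> int) \<Rightarrow> 'a \<Rightarrow> 'a \<Rightarrow> real" where
  "val_dist v x y = val_norm v (x - y)"

text \<open>
  The valuation is normalized by the existence of an element of valuation \<open>1\<close>.
\<close>

locale complete_discretely_valued_field =
  fixes v :: "'a::field \<Rightarrow> int"
  assumes val_mult: "x \<noteq> 0 \<Longrightarrow> y \<noteq> 0 \<Longrightarrow> v (x * y) = v x + v y"
    and val_add: "x \<noteq> 0 \<Longrightarrow> y \<noteq> 0 \<Longrightarrow> x + y \<noteq> 0 \<Longrightarrow> min (v x) (v y) \<le> v (x + y)"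
    and uniformizer: "\<exists>\<pi>. \<pi> \<noteq> 0 \<and> v \<pi> = 1"
    and finite_residue_field: "finite (residue_field v)"
    and complete: "Metric_space.mcomplete UNIV (val_dist v)"

section \<open>The space \<open>K\<^sup>d\<close>\<close>

text \<open>
  The index type \<open>'n\<close> plays the role of \<open>{1, \<dots>, d}\<close>; where the order of the coordinates
  matters, it is assumed to be linearly ordered.
\<close>

definition sup_norm :: "('a::field \<Rightarrow> int) \<Rightarrow> 'a ^ 'n::finite \<Rightarrow> real" where
  "sup_norm v x = Max (range (\<lambda>i. val_norm v (x $ i)))"

definition sup_dist :: "('a::field \<Rightarrow> int) \<Rightarrow> 'a ^ 'n::finite \<Rightarrow> 'a ^ 'n \<Rightarrow> real" where
  "sup_dist v x y = sup_norm v (x - y)"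

definition vec_topology :: "('a::field \<Rightarrow> int) \<Rightarrow> ('a ^ 'n::finite) topology" where
  "vec_topology v = Metric_space.mtopology UNIV (sup_dist v)"

definition integral_vectors :: "('a::field \<Rightarrow> int) \<Rightarrow> ('a ^ 'n::finite) set" where
  "integral_vectors v = {x. \<forall>i. x $ i \<in> valuation_ring v}"

definition unit_sphere :: "('a::field \<Rightarrow> int) \<Rightarrow> ('a ^ 'n::finite) set" where
  "unit_sphere v = {x. sup_norm v x = 1}"

section \<open>Projective space\<close>

typedef (overloaded) ('a::field, 'n::finite) proj =
  "{L :: ('a ^ 'n) set. vec.subspace L \<and> vec.dim L = 1}"
  morphisms line_of proj_of_line
proof -
  obtain i :: 'n where True by simp
  have "axis i (1::'a) \<noteq> 0"
    by (simp add: axis_eq_0_iff)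
  then have "vec.dim (vec.span {axis i (1::'a)}) = 1"
    by (simp add: vec.dim_span_eq_card_independent)
  then show ?thesis
    using vec.subspace_span by blast
qed

definition unit_reps :: "('a::field \<Rightarrow> int) \<Rightarrow> ('a, 'n::finite) proj \<Rightarrow> ('a ^ 'n) set" where
  "unit_reps v a = line_of a \<inter> unit_sphere v"

definition proj_dist ::
  "('a::field \<Rightarrow> int) \<Rightarrow> ('a, 'n::finite) proj \<Rightarrow> ('a, 'n) proj \<Rightarrow> real" where
  "proj_dist v a b = (INF (x, y) \<in> unit_reps v a \<times> unit_reps v b. sup_dist v x y)"

definition can :: "('a::field \<Rightarrow> int) \<Rightarrow> ('a, 'n) proj \<Rightarrow> 'a ^ 'n::{finite,linorder}" where
  "can v a = (THE x. x \<in> unit_reps v a \<and>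
     (\<exists>j. x $ j = 1 \<and> (\<forall>i<j. val_norm v (x $ i) < 1)))"

section \<open>The function space and the Kakeya sets\<close>

definition lipschitz_maps ::
  "('a::field \<Rightarrow> int) \<Rightarrow> (('a, 'n::finite) proj \<Rightarrow> 'a ^ 'n) set" where
  "lipschitz_maps v = {f. range f \<subseteq> integral_vectors v \<and>
     (\<forall>a b. sup_dist v (f a) (f b) \<le> proj_dist v a b)}"

text \<open>
  The value \<open>0\<close> outside the function space makes the uniform distance nonnegative and
  symmetric everywhere, as \<^locale>\<open>Metric_space\<close> requires.
\<close>

definition uniform_dist ::
  "('a::field \<Rightarrow> int) \<Rightarrow> (('a, 'n::finite) proj \<Rightarrow> 'a ^ 'n) \<Rightarrow> (('a, 'n) proj \<Rightarrow> 'a ^ 'n) \<Rightarrow> real" where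
  "uniform_dist v f g =
     (if f \<in> lipschitz_maps v \<and> g \<in> lipschitz_maps v
      then SUP a. sup_dist v (f a) (g a) else 0)"

definition lipschitz_topology ::
  "('a::field \<Rightarrow> int) \<Rightarrow> (('a, 'n::finite) proj \<Rightarrow> 'a ^ 'n) topology" where
  "lipschitz_topology v = Metric_space.mtopology (lipschitz_maps v) (uniform_dist v)"

definition kakeya_set ::
  "('a::field \<Rightarrow> int) \<Rightarrow> (('a, 'n) proj \<Rightarrow> 'a ^ 'n::{finite,linorder}) \<Rightarrow>
     ('a ^ 'n::{finite,linorder}) set" where
  "kakeya_set v f = (\<Union>a. {t *s can v a + f a | t. t \<in> valuation_ring v})"

section \<open>Haar measures\<close>

text \<open>
  \<open>T\<close> is meant to be a locally compact Hausdorff group topology on a subgroup \<open>topspace T\<close>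
  of an abelian group. A Haar measure is a nonzero translation-invariant Radon measure
  on its Borel sets.
\<close>

definition haar_measure :: "'b::ab_group_add topology \<Rightarrow> 'b measure \<Rightarrow> bool" where
  "haar_measure T M \<longleftrightarrow>
     space M = topspace T \<and>
     sets M = sigma_sets (topspace T) {U. openin T U} \<and>
     emeasure M (space M) \<noteq> 0 \<and>
     (\<forall>g \<in> topspace T. \<forall>A \<in> sets M. emeasure M ((+) g ` A) = emeasure M A) \<and>
     (\<forall>C. compactin T C \<longrightarrow> emeasure M C < \<infinity>) \<and>
     (\<forall>A \<in> sets M. emeasure M A = (INF U \<in> {U. openin T U \<and> A \<subseteq> U}. emeasure M U)) \<and>
     (\<forall>U. openin T U \<longrightarrow> emeasure M U = (SUP C \<in> {C. compactin T C \<and> C \<subseteq> U}. emeasure M C))"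

end

theory Submission
  imports Defs
begin

text \<open>
  By Fubini it suffices that a given point \<open>x\<close> is hit modulo \<open>\<pi>\<^sup>n\<close> by \<open>N(f)\<close> with a
  probability that tends to \<open>0\<close> uniformly in \<open>x\<close>. In an affine chart of the projective space the
  cells modulo \<open>\<pi>\<^sup>m\<close> form a tree in which every vertex has \<open>Q = q\<^bsup>d-1\<^esup>\<close> children, and a cell
  whose line passes through \<open>x\<close> modulo \<open>\<pi>\<^sup>m\<close> has each child doing so modulo \<open>\<pi>\<^bsup>m+1\<^esup>\<close> with
  probability \<open>1/Q\<close>, independently. This is a critical Galton--Watson process, which dies out
  almost surely.
\<close>

text \<open>Criticality is a count of dimensions. A direction in the chart \<open>w $ j = 1\<close>
  and the position of \<open>x\<close> relative to a line in that direction both have d - 1 free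
  coordinates. So a cell has as many children as a child has possible residues, and exactly one
  residue is a hit. The process dies out because d \<ge> 2 makes Q \<ge> 2, and the decay comes from
  a second-order term. The Haar measure is known only through translation invariance, and no
  coordinates are at hand in which the cells are independent. The randomness is therefore drawn from
  translations by Lipschitz bumps: a constant divisible by \<open>unif ^ m\<close> may be added on a
  single cell of level \<open>Suc m\<close>. The probabilistic estimate concerns congruences only.
  For the set itself one also needs measurability, which comes from closedness; this is the purpose
  of the compactness argument and of the completeness of K.\<close>

context complete_discretely_valued_field
begin

section \<open>Ideal powers and congruences\<close>

text \<open>The powers of the maximal ideal; \<open>0\<close> is put in by hand because
  \<open>v 0\<close> is arbitrary.\<close>

definition mpow :: "nat \<Rightarrow> 'a set" where
  "mpow n = {x. x = 0 \<or> int n \<le> v x}"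

lemma mpow_0: "mpow 0 = valuation_ring v"
  by (simp add: mpow_def valuation_ring_def)

lemma mpow_1: "mpow (Suc 0) = maximal_ideal v"
  by (simp add: mpow_def maximal_ideal_def)

lemma val_one: "v 1 = 0"
  using val_mult[of 1 1] by simp

lemma val_minus: "v (- x) = v x"
proof (cases "x = 0")
  case False
  have "v (- 1) = 0"
    using val_mult[of "- 1" "- 1"] val_one by simp
  then show ?thesis
    using val_mult[of "- 1" x] False by simp
qed simp

lemma val_inverse: "x \<noteq> 0 \<Longrightarrow> v (inverse x) = - v x"
  using val_mult[of x "inverse x"] val_one by simp

lemma val_power: "x \<noteq> 0 \<Longrightarrow> v (x ^ n) = int n * v x"
  by (induction n) (auto simp: val_one val_mult algebra_simps)

lemma zero_mpow [simp]: "0 \<in> mpow n"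
  by (simp add: mpow_def)

lemma one_mpow [simp]: "1 \<in> mpow 0"
  by (simp add: mpow_def val_one)

lemma one_notin_mpow [simp]: "1 \<notin> mpow (Suc n)"
  by (simp add: mpow_def val_one)

lemma mpow_add: "x \<in> mpow n \<Longrightarrow> y \<in> mpow n \<Longrightarrow> x + y \<in> mpow n"
  using val_add[of x y] by (fastforce simp: mpow_def)

lemma mpow_minus: "x \<in> mpow n \<Longrightarrow> - x \<in> mpow n"
  by (simp add: mpow_def val_minus)

lemma mpow_diff: "x \<in> mpow n \<Longrightarrow> y \<in> mpow n \<Longrightarrow> x - y \<in> mpow n"
  using mpow_add[of x n "- y"] mpow_minus[of y n] by simp

lemma mpow_mult: "x \<in> mpow m \<Longrightarrow> y \<in> mpow n \<Longrightarrow> x * y \<in> mpow (m + n)"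
  by (cases "x = 0 \<or> y = 0") (auto simp: mpow_def val_mult)

lemma mpow_mult_int: "x \<in> mpow 0 \<Longrightarrow> y \<in> mpow n \<Longrightarrow> x * y \<in> mpow n"
  using mpow_mult[of x 0 y n] by simp

lemma mpow_antimono: "m \<le> n \<Longrightarrow> x \<in> mpow n \<Longrightarrow> x \<in> mpow m"
  by (auto simp: mpow_def)

lemma mpow_sub_comm: "x - y \<in> mpow n \<Longrightarrow> y - x \<in> mpow n"
  using mpow_minus[of "x - y" n] by simp

lemma mpow_Inter: "(\<And>n. x \<in> mpow n) \<Longrightarrow> x = 0"
proof (rule ccontr)
  assume *: "\<And>n. x \<in> mpow n" and "x \<noteq> 0"
  then show False using *[of "nat (v x + 1)"] by (simp add: mpow_def split: if_splits)
qed

definition unif :: 'a where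
  "unif = (SOME p. p \<noteq> 0 \<and> v p = 1)"

lemma unif: "unif \<noteq> 0" "v unif = 1"
  using someI_ex[OF uniformizer] by (auto simp: unif_def)

lemma unif_power_mpow: "unif ^ n \<in> mpow n"
  by (simp add: mpow_def val_power unif)

lemma unif_power_mult_iff: "unif ^ m * x \<in> mpow (m + n) \<longleftrightarrow> x \<in> mpow n"
proof (cases "x = 0")
  case False
  then show ?thesis using val_mult[of "unif ^ m" x]
    by (simp add: mpow_def val_power unif)
qed simp

lemma mpow_eq_unif_mult:
  assumes "x \<in> mpow n"
  obtains y where "y \<in> mpow 0" "x = unif ^ n * y"
proof
  show "x = unif ^ n * (x / unif ^ n)" using unif by simp
  then show "x / unif ^ n \<in> mpow 0"
    using assms unif_power_mult_iff[of n "x / unif ^ n" 0] by simp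
qed

section \<open>Representatives of the residue field\<close>

definition residue_reps :: "'a set" where
  "residue_reps = (\<lambda>X. SOME x. x \<in> X) ` residue_field v"

definition residue_rel :: "('a \<times> 'a) set" where
  "residue_rel = {(x, y). x \<in> valuation_ring v \<and> y \<in> valuation_ring v \<and> x - y \<in> maximal_ideal v}"

lemma residue_rel_iff: "(x, y) \<in> residue_rel \<longleftrightarrow> x \<in> mpow 0 \<and> y \<in> mpow 0 \<and> x - y \<in> mpow (Suc 0)"
  by (simp add: residue_rel_def mpow_0 mpow_1)

lemma residue_field_eq: "residue_field v = mpow 0 // residue_rel"
  by (simp add: residue_field_def residue_rel_def mpow_0)

lemma equiv_residue_rel: "equiv (mpow 0) residue_rel"
proof (rule equivI)
  show "residue_rel \<subseteq> mpow 0 \<times> mpow 0" by (auto simp: residue_rel_iff)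
  show "refl_on (mpow 0) residue_rel" by (auto simp: refl_on_def residue_rel_iff)
  show "sym residue_rel" by (rule symI) (use mpow_sub_comm in \<open>auto simp: residue_rel_iff\<close>)
  show "trans residue_rel"
  proof (rule transI)
    fix x y z assume "(x, y) \<in> residue_rel" "(y, z) \<in> residue_rel"
    then show "(x, z) \<in> residue_rel"
      using mpow_add[of "x - y" "Suc 0" "y - z"] by (simp add: residue_rel_iff)
  qed
qed

lemma residue_field_Some:
  assumes "X \<in> residue_field v"
  shows "(SOME x. x \<in> X) \<in> X"
proof -
  have "X \<noteq> {}"
    using in_quotient_imp_non_empty[OF equiv_residue_rel] assms by (simp add: residue_field_eq)
  then show ?thesis by (simp add: some_in_eq)
qed

lemma residue_field_subset: "X \<in> residue_field v \<Longrightarrow> X \<subseteq> mpow 0"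
  using in_quotient_imp_subset[OF equiv_residue_rel] by (simp add: residue_field_eq)

lemma residue_reps_integral: "residue_reps \<subseteq> mpow 0"
  using residue_field_Some residue_field_subset unfolding residue_reps_def by blast

lemma finite_residue_reps: "finite residue_reps"
  by (simp add: residue_reps_def finite_residue_field)

lemma residue_reps_cover:
  assumes "x \<in> mpow 0"
  obtains y where "y \<in> residue_reps" "x - y \<in> mpow (Suc 0)"
proof -
  let ?X = "residue_rel `` {x}"
  have X: "?X \<in> residue_field v"
    unfolding residue_field_eq using assms by (rule quotientI)
  then have "(x, SOME y. y \<in> ?X) \<in> residue_rel"
    using residue_field_Some[OF X] by blast
  moreover have "(SOME y. y \<in> ?X) \<in> residue_reps"
    unfolding residue_reps_def using X by blast
  ultimately show thesis
    using that residue_rel_iff by blast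
qed

lemma residue_classes_eq:
  assumes "X \<in> residue_field v" "Y \<in> residue_field v" "x \<in> X" "y \<in> Y" "x - y \<in> mpow (Suc 0)"
  shows "X = Y"
proof -
  have "(x, y) \<in> residue_rel"
    using assms residue_field_subset by (auto simp: residue_rel_iff)
  then show ?thesis
    using quotient_eq_iff[OF equiv_residue_rel, of X Y x y] assms by (simp add: residue_field_eq)
qed

lemma residue_reps_unique:
  assumes "x \<in> residue_reps" "y \<in> residue_reps" "x - y \<in> mpow (Suc 0)"
  shows "x = y"
  using assms residue_classes_eq residue_field_Some unfolding residue_reps_def by blast

lemma card_residue_reps: "card residue_reps = card (residue_field v)"
  unfolding residue_reps_def
proof (rule card_image, rule inj_onI)
  fix X Y assume "X \<in> residue_field v" "Y \<in> residue_field v" "(SOME x. x \<in> X) = (SOME x. x \<in> Y)"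
  then show "X = Y"
    using residue_classes_eq[of X Y] residue_field_Some[of X] residue_field_Some[of Y] by simp
qed

text \<open>\<open>0\<close> and \<open>1\<close> have different residues. The bound makes
  \<open>radius n\<close> tend to 0 and later gives Q \<ge> 2.\<close>

lemma card_residue_field_ge_2: "2 \<le> card (residue_field v)"
proof -
  obtain a b where a: "a \<in> residue_reps" "0 - a \<in> mpow (Suc 0)"
    and b: "b \<in> residue_reps" "1 - b \<in> mpow (Suc 0)"
    using residue_reps_cover[OF zero_mpow] residue_reps_cover[OF one_mpow] by metis
  have "a \<noteq> b"
    using mpow_diff[OF b(2) a(2)] by auto
  then have "card {a, b} = 2" by simp
  then show ?thesis
    using card_mono[OF finite_residue_reps, of "{a, b}"] a b by (simp add: card_residue_reps)
qed

text \<open>Induction by digits: an approximation modulo \<open>mpow n\<close> is corrected by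
  \<open>unif ^ n\<close> times a residue representative.\<close>

lemma finite_mpow_reps: "\<exists>F. finite F \<and> (\<forall>x\<in>mpow 0. \<exists>y\<in>F. x - y \<in> mpow n)"
proof (induction n)
  case 0
  show ?case by (intro exI[of _ "{0}"]) auto
next
  case (Suc n)
  then obtain F where F: "finite F" "\<And>x. x \<in> mpow 0 \<Longrightarrow> \<exists>y\<in>F. x - y \<in> mpow n" by blast
  let ?G = "(\<lambda>(y, c). y + unif ^ n * c) ` (F \<times> residue_reps)"
  have "\<exists>z\<in>?G. x - z \<in> mpow (Suc n)" if x: "x \<in> mpow 0" for x
  proof -
    obtain y where y: "y \<in> F" "x - y \<in> mpow n" using F(2)[OF x] by blast
    obtain z where z: "z \<in> mpow 0" "x - y = unif ^ n * z" using mpow_eq_unif_mult[OF y(2)] .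
    obtain c where c: "c \<in> residue_reps" "z - c \<in> mpow (Suc 0)" using residue_reps_cover[OF z(1)] .
    have "x - (y + unif ^ n * c) = unif ^ n * (z - c)" using z(2) by (simp add: algebra_simps)
    then have "x - (y + unif ^ n * c) \<in> mpow (Suc n)"
      using c(2) unif_power_mult_iff[of n "z - c" "Suc 0"] by simp
    then show ?thesis using y(1) c(1) by force
  qed
  then show ?case using F(1) finite_residue_reps by (intro exI[of _ ?G]) auto
qed

section \<open>Norms\<close>

text \<open>Powers of q are ordered like their exponents since q > 1. This lets distances be handled
  as congruences.\<close>

lemma val_norm_le_iff: "val_norm v x \<le> real (card (residue_field v)) powi (- int n) \<longleftrightarrow> x \<in> mpow n"
proof -
  have q: "1 < real (card (residue_field v))" using card_residue_field_ge_2 by linarith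
  then have "real (card (residue_field v)) powi i \<le> real (card (residue_field v)) powi j \<longleftrightarrow> i \<le> j" for i j
    by (smt (verit, best) power_int_increasing power_int_strict_increasing)
  then show ?thesis using q by (auto simp: val_norm_def mpow_def zero_le_power_int)
qed

lemma val_norm_nonneg: "0 \<le> val_norm v x"
  by (simp add: val_norm_def)

lemma val_norm_zero_iff: "val_norm v x = 0 \<longleftrightarrow> x = 0"
  using card_residue_field_ge_2 by (simp add: val_norm_def)

lemma val_norm_le_1_iff: "val_norm v x \<le> 1 \<longleftrightarrow> x \<in> mpow 0"
  using val_norm_le_iff[of x 0] by simp

lemma val_norm_mult: "val_norm v (x * y) = val_norm v x * val_norm v y"
  using card_residue_field_ge_2 by (auto simp: val_norm_def val_mult simp flip: power_int_add)

lemma val_norm_minus: "val_norm v (- x) = val_norm v x"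
  by (simp add: val_norm_def val_minus)

lemma val_norm_one: "val_norm v 1 = 1"
  by (simp add: val_norm_def val_one)

lemma val_norm_add: "val_norm v (x + y) \<le> max (val_norm v x) (val_norm v y)"
proof (cases "x = 0 \<or> y = 0 \<or> x + y = 0")
  case True
  then show ?thesis using val_norm_nonneg by (auto simp: val_norm_def max_def)
next
  case False
  let ?q = "real (card (residue_field v))"
  have q: "1 \<le> ?q" using card_residue_field_ge_2 by linarith
  have "?q powi - v (x + y) \<le> ?q powi - min (v x) (v y)"
    using False val_add[of x y] q by (intro power_int_increasing) auto
  then show ?thesis using False by (auto simp: val_norm_def min_def max_def split: if_splits)
qed

definition radius :: "nat \<Rightarrow> real" where
  "radius n = real (card (residue_field v)) powi (- int n)"

lemma radius_pos: "0 < radius n"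
  using card_residue_field_ge_2 by (simp add: radius_def zero_less_power_int)

lemma radius_eq: "radius n = (1 / real (card (residue_field v))) ^ n"
  by (simp add: radius_def power_int_minus power_one_over inverse_eq_divide)

lemma radius_arbitrarily_small:
  assumes "0 < e"
  obtains n where "radius n < e"
proof -
  have "1 / real (card (residue_field v)) < 1" using card_residue_field_ge_2 by simp
  then show thesis using real_arch_pow_inv[OF assms] that unfolding radius_eq by blast
qed

lemma sup_norm_le_iff: "sup_norm v x \<le> c \<longleftrightarrow> (\<forall>i. val_norm v (x $ i) \<le> c)"
  by (auto simp: sup_norm_def)

lemma sup_norm_ge: "val_norm v (x $ i) \<le> sup_norm v x"
  using sup_norm_le_iff by blast

lemma sup_norm_attained: obtains i where "sup_norm v x = val_norm v (x $ i)"
proof -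
  have "sup_norm v x \<in> range (\<lambda>i. val_norm v (x $ i))"
    unfolding sup_norm_def by (rule Max_in) auto
  then show thesis using that by blast
qed

lemma sup_norm_nonneg: "0 \<le> sup_norm v x"
  using sup_norm_ge val_norm_nonneg order_trans by blast

lemma sup_norm_zero_iff: "sup_norm v x = 0 \<longleftrightarrow> x = 0"
proof
  assume "sup_norm v x = 0"
  then have "val_norm v (x $ i) = 0" for i
    by (metis sup_norm_ge val_norm_nonneg antisym)
  then show "x = 0" by (simp add: val_norm_zero_iff vec_eq_iff)
qed (auto simp: sup_norm_def val_norm_def)

lemma sup_norm_minus: "sup_norm v (- x) = sup_norm v x"
  by (simp add: sup_norm_def val_norm_minus)

lemma sup_norm_add: "sup_norm v (x + y) \<le> max (sup_norm v x) (sup_norm v y)"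
  unfolding sup_norm_le_iff
proof
  fix i
  have "val_norm v ((x + y) $ i) \<le> max (val_norm v (x $ i)) (val_norm v (y $ i))"
    using val_norm_add by simp
  then show "val_norm v ((x + y) $ i) \<le> max (sup_norm v x) (sup_norm v y)"
    using sup_norm_ge[of x i] sup_norm_ge[of y i] by linarith
qed

lemma sup_norm_scale: "sup_norm v (c *s x) = val_norm v c * sup_norm v x"
proof -
  obtain i where i: "sup_norm v x = val_norm v (x $ i)" by (rule sup_norm_attained)
  obtain j where j: "sup_norm v (c *s x) = val_norm v ((c *s x) $ j)" by (rule sup_norm_attained)
  have "val_norm v c * val_norm v (x $ j) \<le> val_norm v c * sup_norm v x"
    by (intro mult_left_mono sup_norm_ge val_norm_nonneg)
  then show ?thesis
    using i j sup_norm_ge[of "c *s x" i] by (intro antisym) (simp_all add: val_norm_mult)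
qed

section \<open>Congruences between vectors\<close>

definition vpow :: "nat \<Rightarrow> ('a ^ 'n::finite) set" where
  "vpow n = {x. \<forall>i. x $ i \<in> mpow n}"

lemma vpow_0: "vpow 0 = integral_vectors v"
  by (simp add: vpow_def integral_vectors_def mpow_0)

lemma vpowD: "x \<in> vpow n \<Longrightarrow> x $ i \<in> mpow n"
  by (simp add: vpow_def)

lemma zero_vpow [simp]: "0 \<in> vpow n"
  by (simp add: vpow_def)

lemma vpow_add: "x \<in> vpow n \<Longrightarrow> y \<in> vpow n \<Longrightarrow> x + y \<in> vpow n"
  by (simp add: vpow_def mpow_add)

lemma vpow_diff: "x \<in> vpow n \<Longrightarrow> y \<in> vpow n \<Longrightarrow> x - y \<in> vpow n"
  by (simp add: vpow_def mpow_diff)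

lemma vpow_minus: "x \<in> vpow n \<Longrightarrow> - x \<in> vpow n"
  by (simp add: vpow_def mpow_minus)

lemma vpow_sub_comm: "x - y \<in> vpow n \<Longrightarrow> y - x \<in> vpow n"
  using vpow_minus[of "x - y" n] by simp

lemma vpow_cong_trans: "x - y \<in> vpow n \<Longrightarrow> y - z \<in> vpow n \<Longrightarrow> x - z \<in> vpow n"
  using vpow_add[of "x - y" n "y - z"] by simp

lemma vpow_cong: "x - y \<in> vpow n \<Longrightarrow> x \<in> vpow n \<longleftrightarrow> y \<in> vpow n"
  using vpow_add[of "x - y" n y] vpow_diff[of x n "x - y"] by auto

lemma vpow_antimono: "m \<le> n \<Longrightarrow> x \<in> vpow n \<Longrightarrow> x \<in> vpow m"
  using mpow_antimono by (auto simp: vpow_def)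

lemma vpow_scale: "c \<in> mpow m \<Longrightarrow> x \<in> vpow n \<Longrightarrow> c *s x \<in> vpow (m + n)"
  by (simp add: vpow_def mpow_mult)

lemma vpow_scale_int: "c \<in> mpow 0 \<Longrightarrow> x \<in> vpow n \<Longrightarrow> c *s x \<in> vpow n"
  using vpow_scale[of c 0] by simp

lemma vpow_scale_of_int: "c \<in> mpow n \<Longrightarrow> x \<in> vpow 0 \<Longrightarrow> c *s x \<in> vpow n"
  using vpow_scale[of c n x 0] by simp

lemma vpow_Inter: "(\<And>n. x \<in> vpow n) \<Longrightarrow> x = 0"
  using mpow_Inter by (auto simp: vpow_def vec_eq_iff)

lemma unif_power_vpow: "x \<in> vpow 0 \<Longrightarrow> unif ^ m *s x \<in> vpow m"
  using vpow_scale[OF unif_power_mpow] by fastforce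

lemma unif_power_vpow_iff: "unif ^ m *s x \<in> vpow (m + n) \<longleftrightarrow> x \<in> vpow n"
  by (simp add: vpow_def unif_power_mult_iff)

lemma sup_norm_le_radius_iff: "sup_norm v x \<le> radius n \<longleftrightarrow> x \<in> vpow n"
  by (simp add: sup_norm_le_iff vpow_def radius_def val_norm_le_iff)

lemma sup_norm_le_1_iff: "sup_norm v x \<le> 1 \<longleftrightarrow> x \<in> vpow 0"
  by (simp add: sup_norm_le_iff vpow_def val_norm_le_1_iff)

lemma sup_dist_le_radius_iff: "sup_dist v x y \<le> radius n \<longleftrightarrow> x - y \<in> vpow n"
  by (simp add: sup_dist_def sup_norm_le_radius_iff)

text \<open>The norm is attained at a nonzero integral coordinate. Because of this discreteness the
  Lipschitz inequality need only be tested at radii.\<close>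

lemma sup_norm_eq_radius:
  assumes "x \<in> vpow 0" "x \<noteq> 0"
  obtains n where "sup_norm v x = radius n"
proof -
  obtain i where i: "sup_norm v x = val_norm v (x $ i)" by (rule sup_norm_attained)
  have "x $ i \<noteq> 0"
    using i assms(2) sup_norm_zero_iff val_norm_zero_iff by metis
  moreover have "x $ i \<in> mpow 0" using assms(1) by (rule vpowD)
  ultimately have "val_norm v (x $ i) = radius (nat (v (x $ i)))"
    by (simp add: val_norm_def radius_def mpow_def)
  then show thesis using that i by simp
qed

lemma sup_dist_nonneg: "0 \<le> sup_dist v x y"
  by (simp add: sup_dist_def sup_norm_nonneg)

lemma sup_dist_zero_iff: "sup_dist v x y = 0 \<longleftrightarrow> x = y"
  by (simp add: sup_dist_def sup_norm_zero_iff)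

lemma sup_dist_commute: "sup_dist v x y = sup_dist v y x"
  using sup_norm_minus[of "x - y"] by (simp add: sup_dist_def)

lemma sup_dist_triangle: "sup_dist v x z \<le> sup_dist v x y + sup_dist v y z"
  using sup_norm_add[of "x - y" "y - z"] sup_norm_nonneg[of "x - y"] sup_norm_nonneg[of "y - z"]
  by (simp add: sup_dist_def)

lemma Metric_space_sup_dist: "Metric_space UNIV (sup_dist v)"
  by unfold_locales (auto simp: sup_dist_nonneg sup_dist_zero_iff sup_dist_commute sup_dist_triangle)

lemma Metric_space_val_dist: "Metric_space UNIV (val_dist v)"
proof
  show "val_dist v x y = val_dist v y x" for x y
    using val_norm_minus[of "x - y"] by (simp add: val_dist_def)
  show "val_dist v x z \<le> val_dist v x y + val_dist v y z" for x y z
    using val_norm_add[of "x - y" "y - z"] val_norm_nonneg[of "x - y"] val_norm_nonneg[of "y - z"]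
    by (simp add: val_dist_def)
qed (auto simp: val_dist_def val_norm_nonneg val_norm_zero_iff)

text \<open>Completeness enters here. By the ultrametric inequality the distance from
  \<open>s n\<close> to the limit is bounded by that of a single step, without summing a
  tail.\<close>

lemma mpow_limit:
  assumes "\<And>n. s (Suc n) - s n \<in> mpow n"
  obtains l where "\<And>n. l - s n \<in> mpow n"
proof -
  interpret K: Metric_space UNIV "val_dist v" by (rule Metric_space_val_dist)
  have le: "val_dist v x y \<le> radius n \<longleftrightarrow> x - y \<in> mpow n" for x y n
    by (simp add: val_dist_def radius_def val_norm_le_iff)
  have s: "s (n + k) - s n \<in> mpow n" for n k
  proof (induction k)
    case (Suc k)
    have "s (Suc (n + k)) - s (n + k) \<in> mpow n"
      using assms[of "n + k"] by (rule mpow_antimono[rotated]) simp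
    from mpow_add[OF this Suc] show ?case by simp
  qed simp
  have "K.MCauchy s"
    unfolding K.MCauchy_def
  proof (intro conjI allI impI)
    fix e :: real assume "0 < e"
    then obtain N where N: "radius N < e" by (rule radius_arbitrarily_small)
    have "val_dist v (s n) (s n') < e" if "N \<le> n" "N \<le> n'" for n n'
    proof -
      have "s n - s N \<in> mpow N" "s n' - s N \<in> mpow N"
        using s[of N "n - N"] s[of N "n' - N"] that by auto
      from mpow_diff[OF this] have "val_dist v (s n) (s n') \<le> radius N" by (simp add: le)
      with N show ?thesis by simp
    qed
    then show "\<exists>N. \<forall>n n'. N \<le> n \<longrightarrow> N \<le> n' \<longrightarrow> val_dist v (s n) (s n') < e" by blast
  qed simp
  then obtain l where l: "limitin K.mtopology s l sequentially"
    using complete K.mcomplete_def by blast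
  show thesis
  proof
    fix n
    obtain N where N: "\<And>k. N \<le> k \<Longrightarrow> val_dist v (s k) l < radius n"
      using l radius_pos[of n] unfolding K.limit_metric_sequentially by blast
    have "s (n + N) - l \<in> mpow n" using N[of "n + N"] le[of "s (n + N)" l n] by simp
    from mpow_diff[OF s[of n N] this] show "l - s n \<in> mpow n" by simp
  qed
qed

lemma vpow_limit:
  fixes s :: "nat \<Rightarrow> 'a ^ 'n::finite"
  assumes "\<And>n. s (Suc n) - s n \<in> vpow n"
  obtains l where "\<And>n. l - s n \<in> vpow n"
proof -
  have "\<exists>l. \<forall>n. l - s n $ i \<in> mpow n" for i
    using mpow_limit[of "\<lambda>n. s n $ i"] vpowD[OF assms, of _ i]
    unfolding vector_minus_component by metis
  then obtain l where "\<And>i n. l i - s n $ i \<in> mpow n" by metis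
  then show thesis by (intro that[of "\<chi> i. l i"]) (simp add: vpow_def)
qed

lemma openin_vec_coset: "openin (vec_topology v) {y. y - x \<in> vpow n}"
proof -
  interpret V: Metric_space UNIV "sup_dist v :: 'a ^ 'b \<Rightarrow> _" by (rule Metric_space_sup_dist)
  show ?thesis
    unfolding vec_topology_def V.openin_mtopology
  proof (intro conjI allI impI)
    fix y assume y: "y \<in> {y. y - x \<in> vpow n}"
    have "V.mball y (radius n) \<subseteq> {y. y - x \<in> vpow n}"
    proof
      fix z assume "z \<in> V.mball y (radius n)"
      then have "sup_dist v y z \<le> radius n" by simp
      then have "z - y \<in> vpow n" by (simp add: sup_dist_le_radius_iff vpow_sub_comm)
      then show "z \<in> {y. y - x \<in> vpow n}" using y vpow_cong_trans by blast
    qed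
    then show "\<exists>r>0. V.mball y r \<subseteq> {y. y - x \<in> vpow n}" using radius_pos by blast
  qed simp
qed

lemma topspace_vec_topology [simp]: "topspace (vec_topology v :: ('a ^ 'n::finite) topology) = UNIV"
  unfolding vec_topology_def
  using Metric_space.topspace_mtopology[OF Metric_space_sup_dist] by blast

lemma openin_vec_topologyI:
  assumes "\<And>x. x \<in> U \<Longrightarrow> \<exists>n. {y. y - x \<in> vpow n} \<subseteq> U"
  shows "openin (vec_topology v) U"
proof (subst openin_subopen, intro ballI)
  fix x assume "x \<in> U"
  with assms obtain n where "{y. y - x \<in> vpow n} \<subseteq> U" by blast
  then show "\<exists>T. openin (vec_topology v) T \<and> x \<in> T \<and> T \<subseteq> U"
    using openin_vec_coset[of x n] by (intro exI[of _ "{y. y - x \<in> vpow n}"]) auto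
qed

lemma finite_vec:
  assumes "finite F"
  shows "finite {x :: 'a ^ 'n::finite. \<forall>i. x $ i \<in> F}"
proof -
  have "finite (vec_lambda ` (UNIV \<rightarrow>\<^sub>E F) :: ('a ^ 'n) set)"
    using assms by (intro finite_imageI finite_PiE) auto
  moreover have "{x :: 'a ^ 'n. \<forall>i. x $ i \<in> F} \<subseteq> vec_lambda ` (UNIV \<rightarrow>\<^sub>E F)"
  proof
    fix x :: "'a ^ 'n" assume "x \<in> {x. \<forall>i. x $ i \<in> F}"
    then have "vec_nth x \<in> UNIV \<rightarrow>\<^sub>E F" by (simp add: PiE_UNIV_domain)
    then have "vec_lambda (vec_nth x) \<in> vec_lambda ` (UNIV \<rightarrow>\<^sub>E F)" by (rule imageI)
    then show "x \<in> vec_lambda ` (UNIV \<rightarrow>\<^sub>E F)" by simp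
  qed
  ultimately show ?thesis by (rule finite_subset[rotated])
qed

lemma finite_vpow_reps:
  "\<exists>F :: ('a ^ 'n::finite) set. finite F \<and> (\<forall>x\<in>vpow 0. \<exists>y\<in>F. x - y \<in> vpow n)"
proof -
  obtain F where F: "finite F" "\<And>x. x \<in> mpow 0 \<Longrightarrow> \<exists>y\<in>F. x - y \<in> mpow n"
    using finite_mpow_reps[of n] by metis
  have "\<exists>y\<in>{x. \<forall>i. x $ i \<in> F}. x - y \<in> vpow n" if x: "x \<in> vpow 0" for x :: "'a ^ 'n"
  proof -
    have "\<forall>i. \<exists>y\<in>F. x $ i - y \<in> mpow n" using F(2)[OF vpowD[OF x]] by blast
    then obtain y where "\<And>i. y i \<in> F \<and> x $ i - y i \<in> mpow n" by metis
    then show ?thesis by (intro bexI[of _ "\<chi> i. y i"]) (auto simp: vpow_def)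
  qed
  then show ?thesis using finite_vec[OF F(1)] by blast
qed

section \<open>Affine charts of projective space\<close>

lemma unit_inverse:
  assumes "x \<in> mpow 0" "x \<notin> mpow (Suc 0)"
  shows "x \<noteq> 0" "inverse x \<in> mpow 0"
proof -
  show x: "x \<noteq> 0" using assms by auto
  then have "v x = 0" using assms by (auto simp: mpow_def)
  then show "inverse x \<in> mpow 0" using x by (simp add: mpow_def val_inverse)
qed

lemma val_norm_eq_1D:
  assumes "val_norm v x = 1"
  shows "x \<noteq> 0" "x \<in> mpow 0" "x \<notin> mpow (Suc 0)"
proof -
  show x: "x \<noteq> 0" using assms val_norm_zero_iff[of x] by auto
  show "x \<in> mpow 0" using assms val_norm_le_1_iff[of x] by simp
  show "x \<notin> mpow (Suc 0)"
  proof
    assume "x \<in> mpow (Suc 0)"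
    then have "1 \<le> radius (Suc 0)" using assms val_norm_le_iff[of x "Suc 0"] by (simp add: radius_def)
    then show False using card_residue_field_ge_2 by (simp add: radius_eq)
  qed
qed

text \<open>Each line has at most one vector in a given chart. Unlike for \<open>can\<close>,
  nothing is asked of the earlier coordinates, so the charts overlap and the index type needs no
  order.\<close>

definition chart :: "'n::finite \<Rightarrow> ('a ^ 'n) set" where
  "chart j = {w \<in> vpow 0. w $ j = 1}"

definition dir :: "'a ^ 'n::finite \<Rightarrow> ('a, 'n) proj" where
  "dir w = proj_of_line (vec.span {w})"

lemma chartD: "w \<in> chart j \<Longrightarrow> w \<in> vpow 0" "w \<in> chart j \<Longrightarrow> w $ j = 1" "w \<in> chart j \<Longrightarrow> w \<noteq> 0"
  by (auto simp: chart_def)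

lemma chart_unit_sphere: "w \<in> chart j \<Longrightarrow> w \<in> unit_sphere v"
  using sup_norm_ge[of w j] sup_norm_le_1_iff[of w]
  by (simp add: chart_def unit_sphere_def val_norm_one)

lemma line_of_dir: "w \<noteq> 0 \<Longrightarrow> line_of (dir w) = range (\<lambda>c. c *s w)"
proof -
  assume "w \<noteq> 0"
  then have "vec.dim (vec.span {w}) = 1" by (simp add: vec.dim_span_eq_card_independent)
  then have "line_of (dir w) = vec.span {w}"
    unfolding dir_def by (intro proj_of_line_inverse) (simp add: vec.subspace_span)
  then show ?thesis by (simp add: vec.span_singleton)
qed

lemma dir_exhaust:
  obtains w where "w \<noteq> 0" "a = dir w"
proof -
  have a: "vec.subspace (line_of a)" "vec.dim (line_of a) = 1"
    using line_of[of a] by auto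
  obtain B where B: "vec.independent B" "B \<subseteq> line_of a" "line_of a \<subseteq> vec.span B" "card B = 1"
    using vec.basis_exists[of "line_of a"] a(2) by metis
  then obtain w where w: "B = {w}" by (meson card_1_singletonE)
  have "line_of a = vec.span {w}"
    using B(2,3) vec.span_minimal[OF _ a(1)] w by blast
  moreover have "w \<noteq> 0"
    using B(1) w by auto
  ultimately show thesis
    using that[of w] line_of_inverse[of a] by (simp add: dir_def)
qed

lemma line_of_scale: "x \<in> line_of a \<Longrightarrow> c *s x \<in> line_of a"
  using line_of[of a] vec.subspace_scale by blast

lemma dir_eqI:
  assumes "x \<in> line_of a" "x \<noteq> 0"
  shows "dir x = a"
proof -
  obtain w where w: "w \<noteq> 0" "a = dir w" by (rule dir_exhaust)
  then obtain c where c: "x = c *s w" using assms(1) by (auto simp: line_of_dir)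
  with assms(2) have "c \<noteq> 0" by auto
  then have "w = inverse c *s x" using c by simp
  then have "range (\<lambda>k. k *s w) = range (\<lambda>k. k *s x)"
    unfolding c by (metis (no_types, lifting) line_of_dir w(1) assms(2) c line_of_scale rangeI subset_antisym image_subset_iff vector_smult_assoc)
  then show ?thesis
    using w assms(2) by (metis line_of_dir line_of_inject)
qed

lemma line_of_dir_self: "w \<noteq> 0 \<Longrightarrow> w \<in> line_of (dir w)"
  by (auto simp: line_of_dir intro: range_eqI[of _ _ 1])

lemma unit_repsD:
  assumes "u \<in> unit_reps v a"
  shows "u \<in> vpow 0" "u \<noteq> 0" "u \<in> line_of a" "dir u = a"
proof -
  have u: "u \<in> line_of a" "sup_norm v u = 1" using assms by (auto simp: unit_reps_def unit_sphere_def)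
  then show "u \<in> vpow 0" "u \<in> line_of a" using sup_norm_le_1_iff[of u] by auto
  show "u \<noteq> 0" using u sup_norm_zero_iff[of u] by auto
  then show "dir u = a" using u dir_eqI by blast
qed

lemma chart_unit_reps: "w \<in> chart j \<Longrightarrow> w \<in> unit_reps v (dir w)"
  by (simp add: unit_reps_def chart_unit_sphere line_of_dir_self chartD(3))

lemma unit_reps_scale:
  assumes "u \<in> unit_reps v a" "w \<in> unit_reps v a"
  obtains c where "w = c *s u" "val_norm v c = 1"
proof -
  have "w \<in> range (\<lambda>c. c *s u)"
    using assms unit_repsD line_of_dir by metis
  then obtain c where c: "w = c *s u" by blast
  have "sup_norm v w = 1" "sup_norm v u = 1"
    using assms by (auto simp: unit_reps_def unit_sphere_def)
  then have "val_norm v c = 1" using sup_norm_scale[of c u] c by simp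
  with c that show thesis by blast
qed

lemma chart_inj:
  assumes "w \<in> chart j" "w' \<in> chart j" "dir w = dir w'"
  shows "w = w'"
proof -
  obtain c where "w' = c *s w"
    using unit_reps_scale[of w "dir w" w'] chart_unit_reps assms by metis
  then show ?thesis using assms by (auto simp: chart_def)
qed

lemma can_exists:
  fixes a :: "('a, 'n::{finite,linorder}) proj"
  shows "\<exists>x. x \<in> unit_reps v a \<and> (\<exists>j. x $ j = 1 \<and> (\<forall>i<j. val_norm v (x $ i) < 1))"
proof -
  obtain w where w: "w \<noteq> 0" "a = dir w" by (rule dir_exhaust)
  let ?J = "{j. val_norm v (w $ j) = sup_norm v w}"
  \<comment> \<open>The first coordinate of maximal norm: dividing by it turns it into 1 and brings
    all earlier ones below norm 1.\<close>
  define j where "j = Min ?J"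
  obtain i where "sup_norm v w = val_norm v (w $ i)" by (rule sup_norm_attained)
  then have "?J \<noteq> {}" by auto
  then have j: "val_norm v (w $ j) = sup_norm v w" and j_min: "\<And>i. i \<in> ?J \<Longrightarrow> j \<le> i"
    using Min_in[of ?J] by (auto simp: j_def)
  define x where "x = inverse (w $ j) *s w"
  have "0 < sup_norm v w" using w sup_norm_zero_iff[of w] sup_norm_nonneg[of w] by linarith
  then have nz: "w $ j \<noteq> 0" using j val_norm_zero_iff[of "w $ j"] by auto
  have inv: "val_norm v (inverse (w $ j)) * sup_norm v w = 1"
    using val_norm_mult[of "inverse (w $ j)" "w $ j"] nz j by (simp add: val_norm_one)
  have "sup_norm v x = 1" using inv by (simp add: x_def sup_norm_scale)
  moreover have "x \<in> line_of a" using w by (simp add: x_def line_of_dir_self line_of_scale)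
  moreover have "x $ j = 1" using nz by (simp add: x_def)
  moreover have "val_norm v (x $ i) < 1" if "i < j" for i
  proof -
    have "val_norm v (w $ i) \<noteq> sup_norm v w" using j_min[of i] that by auto
    then have "val_norm v (w $ i) < sup_norm v w" using sup_norm_ge[of w i] by simp
    moreover have "0 < val_norm v (inverse (w $ j))" using inv val_norm_nonneg[of "inverse (w $ j)"]
      by (metis less_eq_real_def mult_zero_left zero_neq_one)
    ultimately have "val_norm v (inverse (w $ j)) * val_norm v (w $ i) < 1"
      using inv by (metis mult_strict_left_mono)
    then show ?thesis by (simp add: x_def val_norm_mult)
  qed
  ultimately show ?thesis by (auto simp: unit_reps_def unit_sphere_def)
qed

text \<open>The two vectors differ by a factor of norm 1, which preserves coordinate norms. Hence
  \<open>j\<close> and \<open>k\<close> are both the first index of norm 1, and the factor is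
  1.\<close>

lemma can_unique:
  fixes a :: "('a, 'n::{finite,linorder}) proj"
  assumes "x \<in> unit_reps v a" "x $ j = 1" "\<And>i. i < j \<Longrightarrow> val_norm v (x $ i) < 1"
    and "y \<in> unit_reps v a" "y $ k = 1" "\<And>i. i < k \<Longrightarrow> val_norm v (y $ i) < 1"
  shows "x = y"
proof -
  obtain c where c: "y = c *s x" "val_norm v c = 1" using unit_reps_scale assms by metis
  then have norm: "val_norm v (y $ i) = val_norm v (x $ i)" for i by (simp add: val_norm_mult)
  have "val_norm v (x $ k) = 1" "val_norm v (y $ j) = 1"
    using norm[of k] norm[of j] assms(2,5) by (simp_all add: val_norm_one)
  then have "\<not> k < j" "\<not> j < k"
    using assms(3)[of k] assms(6)[of j] by auto
  then have "j = k" by simp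
  then have "c = 1" using c assms(2,5) by simp
  then show ?thesis using c by simp
qed

lemma can_in_unit_reps: "can v a \<in> unit_reps v a"
  and can_in_chart: "\<exists>j. can v a \<in> chart j"
proof -
  have ex1: "\<exists>!x. x \<in> unit_reps v a \<and> (\<exists>j. x $ j = 1 \<and> (\<forall>i<j. val_norm v (x $ i) < 1))"
    by (rule ex_ex1I[OF can_exists]) (elim conjE exE, rule can_unique[of _ a], auto)
  have *: "can v a \<in> unit_reps v a \<and> (\<exists>j. can v a $ j = 1 \<and> (\<forall>i<j. val_norm v (can v a $ i) < 1))"
    unfolding can_def by (rule theI'[OF ex1])
  then show "can v a \<in> unit_reps v a" by blast
  with * show "\<exists>j. can v a \<in> chart j" using unit_repsD(1) by (auto simp: chart_def)
qed

section \<open>Lipschitz maps\<close>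

lemma proj_dist_le:
  assumes "u \<in> unit_reps v a" "w \<in> unit_reps v b"
  shows "proj_dist v a b \<le> sup_dist v u w"
  unfolding proj_dist_def
  using assms by (intro cINF_lower2[where x = "(u, w)"] bdd_belowI2[of _ 0]) (auto simp: sup_dist_nonneg)

lemma unit_reps_nonempty: "unit_reps v (a :: ('a, 'n::finite) proj) \<noteq> {}"
proof -
  obtain w where w: "w \<noteq> 0" "a = dir w" by (rule dir_exhaust)
  obtain i where i: "sup_norm v w = val_norm v (w $ i)" by (rule sup_norm_attained)
  then have nz: "w $ i \<noteq> 0" using w(1) sup_norm_zero_iff val_norm_zero_iff by metis
  have "sup_norm v (inverse (w $ i) *s w) = 1"
    using val_norm_mult[of "inverse (w $ i)" "w $ i"] nz i by (simp add: sup_norm_scale val_norm_one)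
  then have "inverse (w $ i) *s w \<in> unit_reps v a"
    using w by (simp add: unit_reps_def unit_sphere_def line_of_dir_self line_of_scale)
  then show ?thesis by blast
qed

lemma le_proj_dist:
  assumes "\<And>u w. u \<in> unit_reps v a \<Longrightarrow> w \<in> unit_reps v b \<Longrightarrow> c \<le> sup_dist v u w"
  shows "c \<le> proj_dist v a b"
  unfolding proj_dist_def using assms unit_reps_nonempty
  by (intro cINF_greatest) auto

text \<open>The infimum over representatives disappears: distances between integral vectors are 0 or
  a radius, so being 1-Lipschitz means that congruent representatives have values congruent to the
  same modulus.\<close>

lemma lipschitz_maps_iff:
  fixes f :: "('a, 'n::finite) proj \<Rightarrow> 'a ^ 'n"
  shows "f \<in> lipschitz_maps v \<longleftrightarrow> (\<forall>a. f a \<in> vpow 0) \<and>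
     (\<forall>a b u w n. u \<in> unit_reps v a \<longrightarrow> w \<in> unit_reps v b \<longrightarrow> u - w \<in> vpow n \<longrightarrow> f a - f b \<in> vpow n)"
  (is "_ \<longleftrightarrow> ?I \<and> ?L")
proof -
  have "(\<forall>a b. sup_dist v (f a) (f b) \<le> proj_dist v a b) \<longleftrightarrow> ?L"
  proof
    assume lip: "\<forall>a b. sup_dist v (f a) (f b) \<le> proj_dist v a b"
    show ?L
    proof (intro allI impI)
      fix a b :: "('a, 'n) proj" and u w n assume "u \<in> unit_reps v a" "w \<in> unit_reps v b" "u - w \<in> vpow n"
      then have "sup_dist v (f a) (f b) \<le> radius n"
        using lip proj_dist_le sup_dist_le_radius_iff order_trans by metis
      then show "f a - f b \<in> vpow n" by (simp add: sup_dist_le_radius_iff)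
    qed
  next
    assume L: ?L
    show "\<forall>a b. sup_dist v (f a) (f b) \<le> proj_dist v a b"
    proof (intro allI le_proj_dist)
      fix a b :: "('a, 'n) proj" and u w assume uw: "u \<in> unit_reps v a" "w \<in> unit_reps v b"
      show "sup_dist v (f a) (f b) \<le> sup_dist v u w"
      proof (cases "u = w")
        case True
        then have "a = b" using uw unit_repsD(4) by blast
        then show ?thesis using sup_dist_zero_iff[of "f a" "f b"] sup_dist_nonneg[of u w] by simp
      next
        case False
        then obtain n where n: "sup_dist v u w = radius n"
          using sup_norm_eq_radius[of "u - w"] vpow_diff[OF unit_repsD(1) unit_repsD(1), OF uw]
          by (auto simp: sup_dist_def)
        then have "u - w \<in> vpow n" using sup_dist_le_radius_iff[of u w n] by simp
        with L uw have "f a - f b \<in> vpow n" by blast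
        then show ?thesis by (simp add: n sup_dist_le_radius_iff)
      qed
    qed
  qed
  then show ?thesis by (auto simp: lipschitz_maps_def vpow_0)
qed

lemma lipschitz_integral: "f \<in> lipschitz_maps v \<Longrightarrow> f a \<in> vpow 0"
  by (simp add: lipschitz_maps_iff)

lemma lipschitz_cong:
  assumes "f \<in> lipschitz_maps v" "u \<in> chart j" "w \<in> chart k" "u - w \<in> vpow n"
  shows "f (dir u) - f (dir w) \<in> vpow n"
  using assms chart_unit_reps unfolding lipschitz_maps_iff by blast

lemma lipschitz_add:
  fixes f :: "('a, 'n::finite) proj \<Rightarrow> 'a ^ 'n"
  assumes "f \<in> lipschitz_maps v" "g \<in> lipschitz_maps v"
  shows "f + g \<in> lipschitz_maps v"
  unfolding lipschitz_maps_iff plus_fun_def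
proof (intro conjI allI impI)
  show "f a + g a \<in> vpow 0" for a using assms by (simp add: lipschitz_maps_iff vpow_add)
next
  fix a b :: "('a, 'n) proj" and u w n assume "u \<in> unit_reps v a" "w \<in> unit_reps v b" "u - w \<in> vpow n"
  then have "f a - f b \<in> vpow n" "g a - g b \<in> vpow n" using assms unfolding lipschitz_maps_iff by blast+
  from vpow_add[OF this] show "f a + g a - (f b + g b) \<in> vpow n" by (simp add: algebra_simps)
qed

lemma lipschitz_minus: "f \<in> lipschitz_maps v \<Longrightarrow> - f \<in> lipschitz_maps v"
  unfolding lipschitz_maps_iff fun_Compl_def
  by (metis (no_types, lifting) minus_diff_minus vpow_minus)

section \<open>Cells of a chart and bump maps on them\<close>

definition cell :: "'n::finite \<Rightarrow> 'a ^ 'n \<Rightarrow> nat \<Rightarrow> ('a, 'n) proj set" where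
  "cell j u n = dir ` {w \<in> chart j. w - u \<in> vpow n}"

lemma dir_in_cell_iff: "w \<in> chart j \<Longrightarrow> dir w \<in> cell j u n \<longleftrightarrow> w - u \<in> vpow n"
  using chart_inj unfolding cell_def by blast

lemma cell_mono:
  assumes "m \<le> n" "u' - u \<in> vpow m"
  shows "cell j u' n \<subseteq> cell j u m"
  unfolding cell_def using assms vpow_antimono vpow_cong_trans by blast

text \<open>Congruence modulo the maximal ideal keeps coordinate \<open>j\<close> a unit, so the
  second representative can be rescaled into the same chart. Hence the modulus \<open>Suc m\<close>:
  modulo \<open>vpow 0\<close> the second line may leave the chart.\<close>

lemma cell_cong:
  assumes "a \<in> cell j u (Suc m)" "x \<in> unit_reps v a" "y \<in> unit_reps v b" "x - y \<in> vpow (Suc m)"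
  shows "b \<in> cell j u (Suc m)"
proof -
  obtain w where w: "w \<in> chart j" "w - u \<in> vpow (Suc m)" "a = dir w"
    using assms(1) by (auto simp: cell_def)
  obtain c where c: "x = c *s w" "val_norm v c = 1"
    using unit_reps_scale[OF chart_unit_reps[OF w(1)]] assms(2) w(3) by metis
  have diff: "c - y $ j \<in> mpow (Suc m)"
    using vpowD[OF assms(4), of j] c(1) chartD(2)[OF w(1)] by simp
  have "y $ j \<notin> mpow (Suc 0)"
    using val_norm_eq_1D(3)[OF c(2)] mpow_add[OF mpow_antimono[OF _ diff, of "Suc 0"], of "y $ j"] by auto
  moreover have "y $ j \<in> mpow 0" using unit_repsD(1)[OF assms(3)] vpowD by blast
  ultimately have nz: "y $ j \<noteq> 0" and inv: "inverse (y $ j) \<in> mpow 0" using unit_inverse by auto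
  define z where "z = inverse (y $ j) *s y"
  have z: "z \<in> chart j"
    using nz inv unit_repsD(1)[OF assms(3)] vpow_scale_int by (simp add: z_def chart_def)
  have "dir z = b"
    using chartD(3)[OF z] unit_repsD(3)[OF assms(3)] by (intro dir_eqI) (simp_all add: z_def line_of_scale)
  \<comment> \<open>Both summands are small: the first by assumption, the second because
    \<open>y $ j\<close> approximates the factor \<open>c\<close>.\<close>
  have "y - y $ j *s w = (y - x) + (c - y $ j) *s w"
    by (simp add: c(1) vector_sub_rdistrib)
  then have "y - y $ j *s w \<in> vpow (Suc m)"
    using vpow_add[OF vpow_sub_comm[OF assms(4)] vpow_scale_of_int[OF diff chartD(1)[OF w(1)]]] by simp
  moreover have "z - w = inverse (y $ j) *s (y - y $ j *s w)"
    using nz by (simp add: z_def vector_ssub_ldistrib)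
  ultimately have "z - w \<in> vpow (Suc m)" by (simp only: vpow_scale_int[OF inv])
  then show ?thesis
    using z \<open>dir z = b\<close> w(2) vpow_cong_trans dir_in_cell_iff by blast
qed

text \<open>Up to modulus \<open>m\<close> the two values are congruent because \<open>c\<close>
  itself is small; beyond it, \<open>cell_cong\<close> puts both lines inside the cell or both
  outside.\<close>

lemma bump_lipschitz:
  fixes u :: "'a ^ 'n::finite"
  assumes "c \<in> vpow m"
  shows "(\<lambda>a. if a \<in> cell j u (Suc m) then c else 0) \<in> lipschitz_maps v"
  unfolding lipschitz_maps_iff
proof (intro conjI allI impI)
  fix a b :: "('a, 'n) proj" and x y n assume xy: "x \<in> unit_reps v a" "y \<in> unit_reps v b" "x - y \<in> vpow n"
  show "(if a \<in> cell j u (Suc m) then c else 0) - (if b \<in> cell j u (Suc m) then c else 0) \<in> vpow n"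
  proof (cases "n \<le> m")
    case True
    then have "c \<in> vpow n" using assms vpow_antimono by blast
    then show ?thesis by (auto simp: vpow_minus)
  next
    case False
    then have "x - y \<in> vpow (Suc m)" using xy(3) vpow_antimono[of "Suc m" n] by simp
    then have "a \<in> cell j u (Suc m) \<longleftrightarrow> b \<in> cell j u (Suc m)"
      using cell_cong xy vpow_sub_comm by metis
    then show ?thesis by auto
  qed
qed (use assms vpow_antimono[of 0 m] in auto)

section \<open>The uniform metric on the function space\<close>

lemma sup_dist_integral_le_1: "x \<in> vpow 0 \<Longrightarrow> y \<in> vpow 0 \<Longrightarrow> sup_dist v x y \<le> 1"
  using vpow_diff[of x 0 y] by (simp add: sup_dist_def sup_norm_le_1_iff)

lemma sup_dist_le_uniform_dist:
  assumes "f \<in> lipschitz_maps v" "g \<in> lipschitz_maps v"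
  shows "sup_dist v (f a) (g a) \<le> uniform_dist v f g"
  unfolding uniform_dist_def using assms
  by (simp, intro cSUP_upper bdd_aboveI2[where M = 1])
    (auto intro: sup_dist_integral_le_1 lipschitz_integral)

lemma uniform_dist_le:
  assumes "f \<in> lipschitz_maps v" "g \<in> lipschitz_maps v" "\<And>a. sup_dist v (f a) (g a) \<le> c"
  shows "uniform_dist v f g \<le> c"
  unfolding uniform_dist_def using assms by (simp, intro cSUP_least) auto

lemma Metric_space_uniform_dist:
  "Metric_space (lipschitz_maps v) (uniform_dist v :: (('a, 'n::finite) proj \<Rightarrow> 'a ^ 'n) \<Rightarrow> _)"
proof
  fix f g h :: "('a, 'n) proj \<Rightarrow> 'a ^ 'n"
  show "0 \<le> uniform_dist v f g"
  proof (cases "f \<in> lipschitz_maps v \<and> g \<in> lipschitz_maps v")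
    case True
    then show ?thesis
      using sup_dist_le_uniform_dist[of f g undefined] sup_dist_nonneg[of "f undefined" "g undefined"]
      by linarith
  qed (auto simp: uniform_dist_def)
  show "uniform_dist v f g = uniform_dist v g f"
    by (simp add: uniform_dist_def sup_dist_commute)
  assume f: "f \<in> lipschitz_maps v" and g: "g \<in> lipschitz_maps v"
  show "uniform_dist v f g = 0 \<longleftrightarrow> f = g"
  proof
    assume "uniform_dist v f g = 0"
    then have "sup_dist v (f a) (g a) = 0" for a
      using sup_dist_le_uniform_dist[OF f g, of a] sup_dist_nonneg[of "f a" "g a"] by linarith
    then show "f = g" by (auto simp: sup_dist_zero_iff)
  next
    assume "f = g"
    then show "uniform_dist v f g = 0"
      by (simp add: uniform_dist_def sup_dist_zero_iff[THEN iffD2])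
  qed
  assume h: "h \<in> lipschitz_maps v"
  show "uniform_dist v f h \<le> uniform_dist v f g + uniform_dist v g h"
  proof (rule uniform_dist_le[OF f h])
    show "sup_dist v (f a) (h a) \<le> uniform_dist v f g + uniform_dist v g h" for a
      using sup_dist_le_uniform_dist[OF f g, of a] sup_dist_le_uniform_dist[OF g h, of a]
        sup_dist_triangle[of "f a" "h a" "g a"] by linarith
  qed
qed

text \<open>If membership is decided by values modulo a fixed power, a ball of that radius fits
  around every member. The basic events below are shown measurable in this way.\<close>

lemma openin_lipschitz_topologyI:
  assumes "S \<subseteq> lipschitz_maps v"
    and "\<And>f g. f \<in> S \<Longrightarrow> g \<in> lipschitz_maps v \<Longrightarrow> (\<And>a. g a - f a \<in> vpow n) \<Longrightarrow> g \<in> S"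
  shows "openin (lipschitz_topology v) S"
proof -
  interpret L: Metric_space "lipschitz_maps v" "uniform_dist v :: (('a, 'b) proj \<Rightarrow> 'a ^ 'b) \<Rightarrow> _"
    by (rule Metric_space_uniform_dist)
  have "L.mball f (radius n) \<subseteq> S" if "f \<in> S" for f
  proof
    fix g assume "g \<in> L.mball f (radius n)"
    then have fg: "f \<in> lipschitz_maps v" "g \<in> lipschitz_maps v" "uniform_dist v f g \<le> radius n"
      by auto
    then have "sup_dist v (f a) (g a) \<le> radius n" for a
      using sup_dist_le_uniform_dist order_trans by blast
    then have "g a - f a \<in> vpow n" for a
      by (simp add: sup_dist_le_radius_iff vpow_sub_comm)
    with assms(2) that fg show "g \<in> S" by blast
  qed
  then show ?thesis
    using assms(1) radius_pos[of n] unfolding lipschitz_topology_def L.openin_mtopology by blast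
qed

section \<open>The residual of a chart point\<close>

text \<open>
  With \<open>y = x - f (dir w)\<close>, the point \<open>x\<close> lies on the line \<open>R w + f (dir w)\<close> iff the
  coefficient of \<open>w\<close> is \<open>y $ j\<close>, because \<open>w $ j = 1\<close>.
\<close>

definition residual ::
  "'n::finite \<Rightarrow> 'a ^ 'n \<Rightarrow> (('a, 'n) proj \<Rightarrow> 'a ^ 'n) \<Rightarrow> 'a ^ 'n \<Rightarrow> 'a ^ 'n" where
  "residual j x f w = (x - f (dir w)) - (x - f (dir w)) $ j *s w"

lemma residual_cong:
  assumes "x \<in> vpow 0" "g \<in> lipschitz_maps v" "w \<in> chart j"
    and "x - x' \<in> vpow n" "w - w' \<in> vpow n" "f (dir w) - g (dir w') \<in> vpow n"
    and "x' \<in> vpow 0"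
  shows "residual j x f w - residual j x' g w' \<in> vpow n"
proof -
  define y y' where "y = x - f (dir w)" and "y' = x' - g (dir w')"
  have "y - y' = (x - x') - (f (dir w) - g (dir w'))" by (simp add: y_def y'_def)
  then have d: "y - y' \<in> vpow n" using vpow_diff assms by metis
  have y': "y' \<in> vpow 0" using assms by (simp add: y'_def vpow_diff lipschitz_integral)
  \<comment> \<open>The product \<open>y $ j *s w\<close> is bilinear, so its change splits into one
    term for each factor.\<close>
  have eq: "residual j x f w - residual j x' g w' = (y - y') - ((y - y') $ j *s w + y' $ j *s (w - w'))"
    by (simp add: residual_def y_def y'_def vec_eq_iff algebra_simps)
  show ?thesis
    unfolding eq
    by (intro vpow_diff vpow_add d vpow_scale_of_int vpow_scale_int vpowD chartD(1)[OF assms(3)] y' assms(5))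
qed

lemma residual_add:
  assumes "h (dir w) $ j = 0"
  shows "residual j x (f + h) w = residual j x f w - h (dir w)"
  using assms by (simp add: residual_def plus_fun_def vec_eq_iff algebra_simps)

text \<open>For \<open>m \<le> n\<close> this is the survival event of the branching process: the
  vertex \<open>u\<close> of level \<open>m\<close> has a descendant of level
  \<open>n\<close>.\<close>

definition hits ::
  "'n::finite \<Rightarrow> 'a ^ 'n \<Rightarrow> 'a ^ 'n \<Rightarrow> nat \<Rightarrow> nat \<Rightarrow> (('a, 'n) proj \<Rightarrow> 'a ^ 'n) set" where
  "hits j x u m n =
     {f \<in> lipschitz_maps v. \<exists>w\<in>chart j. w - u \<in> vpow m \<and> residual j x f w \<in> vpow n}"

text \<open>Only the values on the cell, modulo \<open>vpow n\<close>, enter the event; a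
  perturbation elsewhere cannot change it.\<close>

lemma hits_cong:
  assumes "x \<in> vpow 0" "f \<in> hits j x u m n" "g \<in> lipschitz_maps v"
    and "\<And>w. w \<in> chart j \<Longrightarrow> w - u \<in> vpow m \<Longrightarrow> f (dir w) - g (dir w) \<in> vpow n"
  shows "g \<in> hits j x u m n"
proof -
  obtain w where w: "w \<in> chart j" "w - u \<in> vpow m" "residual j x f w \<in> vpow n"
    using assms(2) by (auto simp: hits_def)
  have "residual j x f w - residual j x g w \<in> vpow n"
    using assms w by (intro residual_cong) auto
  with w(3) have "residual j x g w \<in> vpow n" using vpow_cong by blast
  with w assms(3) show ?thesis by (auto simp: hits_def)
qed

text \<open>By the Lipschitz condition, moving \<open>w\<close> within the cell changes the residual
  by an element of \<open>vpow m\<close>, so the centre alone decides.\<close>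

lemma hits_diagonal:
  assumes "x \<in> vpow 0" "u \<in> chart j"
  shows "hits j x u m m = {f \<in> lipschitz_maps v. residual j x f u \<in> vpow m}"
proof -
  have "residual j x f u \<in> vpow m"
    if "f \<in> lipschitz_maps v" "w \<in> chart j" "w - u \<in> vpow m" "residual j x f w \<in> vpow m" for f w
  proof -
    have "residual j x f w - residual j x f u \<in> vpow m"
      using that assms by (intro residual_cong) (auto intro: lipschitz_cong)
    with that(4) show ?thesis using vpow_cong by blast
  qed
  then show ?thesis using assms(2) by (auto simp: hits_def intro!: bexI[of _ u])
qed

lemma hits_antimono: "n \<le> n' \<Longrightarrow> hits j x u m n' \<subseteq> hits j x u m n"
  unfolding hits_def using vpow_antimono by blast

section \<open>Subdivision of a cell\<close>

text \<open>These digits have two readings: \<open>u + unif ^ m *s c\<close> runs through the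
  centres of the children of a cell, and \<open>unif ^ m *s c\<close> through the residuals modulo
  \<open>vpow (Suc m)\<close> still possible at level \<open>m\<close>, since coordinate
  \<open>j\<close> of a residual is 0 on the chart. Their common number is Q, whence mean offspring
  1.\<close>

definition chart_reps :: "'n::finite \<Rightarrow> ('a ^ 'n) set" where
  "chart_reps j = {c. c $ j = 0 \<and> (\<forall>i. i \<noteq> j \<longrightarrow> c $ i \<in> residue_reps)}"


lemma chart_reps_finite: "finite (chart_reps j)"
  and card_chart_reps: "card (chart_reps (j :: 'n::finite)) = card (residue_field v) ^ (CARD('n) - 1)"
proof -
  let ?F = "\<lambda>i. if i = j then {0} else residue_reps"
  have "bij_betw vec_nth (chart_reps j) (PiE UNIV ?F)"
  proof (rule bij_betw_byWitness[where f' = vec_lambda])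
    show "vec_nth ` chart_reps j \<subseteq> PiE UNIV ?F"
      by (auto simp: chart_reps_def PiE_UNIV_domain)
    show "vec_lambda ` PiE UNIV ?F \<subseteq> chart_reps j"
      by (auto simp: chart_reps_def PiE_UNIV_domain Pi_iff split: if_splits)
  qed auto
  moreover have "finite (PiE UNIV ?F)"
    by (intro finite_PiE) (auto simp: finite_residue_reps)
  moreover have "card (PiE UNIV ?F) = card (residue_field v) ^ (CARD('n) - 1)"
  proof -
    have "card (PiE UNIV ?F) = (\<Prod>i\<in>UNIV. card (?F i))" by (simp add: card_PiE)
    also have "\<dots> = card (?F j) * (\<Prod>i\<in>UNIV - {j}. card (?F i))" by (rule prod.remove) auto
    also have "\<dots> = card (residue_field v) ^ (CARD('n) - 1)"
      by (simp add: card_residue_reps card_Diff_singleton)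
    finally show ?thesis .
  qed
  ultimately show "finite (chart_reps j)" "card (chart_reps j) = card (residue_field v) ^ (CARD('n) - 1)"
    by (auto simp: bij_betw_finite dest: bij_betw_same_card)
qed

lemma chart_reps_unique:
  assumes "c \<in> chart_reps j" "c' \<in> chart_reps j" "c - c' \<in> vpow (Suc 0)"
  shows "c = c'"
  unfolding vec_eq_iff
proof
  fix i
  show "c $ i = c' $ i"
    using assms residue_reps_unique[of "c $ i" "c' $ i"] vpowD[OF assms(3), of i]
    by (cases "i = j") (auto simp: chart_reps_def)
qed

definition subcell :: "'a ^ 'n::finite \<Rightarrow> nat \<Rightarrow> 'a ^ 'n \<Rightarrow> 'a ^ 'n" where
  "subcell u m c = u + unif ^ m *s c"

lemma chart_reps_integral: "c \<in> chart_reps j \<Longrightarrow> c \<in> vpow 0"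
  using residue_reps_integral by (force simp: chart_reps_def vpow_def)

lemma subcell_cong: "c \<in> chart_reps j \<Longrightarrow> subcell u m c - u \<in> vpow m"
  by (simp add: subcell_def unif_power_vpow chart_reps_integral)

lemma subcell_chart:
  assumes "u \<in> chart j" "c \<in> chart_reps j"
  shows "subcell u m c \<in> chart j"
proof -
  have "unif ^ m *s c \<in> vpow 0"
    using unif_power_vpow[OF chart_reps_integral[OF assms(2)]] vpow_antimono[of 0 m] by blast
  then show ?thesis using assms by (simp add: chart_def subcell_def vpow_add chart_reps_def)
qed

lemma subcell_unique:
  assumes "c \<in> chart_reps j" "c' \<in> chart_reps j" "subcell u m c - subcell u m c' \<in> vpow (Suc m)"
  shows "c = c'"
proof -
  have "unif ^ m *s (c - c') \<in> vpow (m + Suc 0)"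
    using assms(3) by (simp add: subcell_def vector_ssub_ldistrib)
  then show ?thesis using assms chart_reps_unique unif_power_vpow_iff by blast
qed

lemma subcell_cover:
  assumes "u \<in> chart j" "w \<in> chart j" "w - u \<in> vpow m"
  obtains c where "c \<in> chart_reps j" "w - subcell u m c \<in> vpow (Suc m)"
proof -
  have "\<exists>c. (if i = j then c = 0 else c \<in> residue_reps) \<and> (w - u) $ i - unif ^ m * c \<in> mpow (Suc m)" for i
  proof (cases "i = j")
    case True
    then show ?thesis using assms by (auto simp: chart_def)
  next
    case False
    obtain z where z: "z \<in> mpow 0" "(w - u) $ i = unif ^ m * z"
      using mpow_eq_unif_mult[OF vpowD[OF assms(3)]] .
    obtain c where "c \<in> residue_reps" "z - c \<in> mpow (Suc 0)" using residue_reps_cover[OF z(1)] .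
    then show ?thesis
      using False unif_power_mult_iff[of m "z - c" "Suc 0"]
      by (intro exI[of _ c]) (auto simp: z(2) right_diff_distrib simp del: vector_minus_component)
  qed
  then obtain c where c: "\<And>i. if i = j then c i = 0 else c i \<in> residue_reps"
    "\<And>i. (w - u) $ i - unif ^ m * c i \<in> mpow (Suc m)"
    by metis
  show thesis
  proof
    show "vec_lambda c \<in> chart_reps j"
      using c(1) by (auto simp: chart_reps_def split: if_splits)
    show "w - subcell u m (vec_lambda c) \<in> vpow (Suc m)"
      using c(2) by (simp add: vpow_def subcell_def diff_diff_eq)
  qed
qed

section \<open>Kakeya sets are closed\<close>

text \<open>The Kakeya set assembled from all charts, with repetitions, so that neither
  \<open>can\<close> nor an order on the indices is involved.\<close>

definition line_union :: "(('a, 'n::finite) proj \<Rightarrow> 'a ^ 'n) \<Rightarrow> ('a ^ 'n) set" where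
  "line_union f = {x \<in> vpow 0. \<exists>j. \<exists>w\<in>chart j. residual j x f w = 0}"

text \<open>At level 0 the cell of \<open>axis j 1\<close> is the whole chart, so these are the root
  events of d trees.\<close>

definition hits_mod :: "'a ^ 'n::finite \<Rightarrow> nat \<Rightarrow> (('a, 'n) proj \<Rightarrow> 'a ^ 'n) set" where
  "hits_mod x n = (\<Union>j. hits j x (axis j 1) 0 n)"

lemma axis_chart: "axis j 1 \<in> chart j"
  by (simp add: chart_def vpow_def axis_def)

lemma hits_mod_iff:
  assumes "f \<in> lipschitz_maps v"
  shows "f \<in> hits_mod x n \<longleftrightarrow> (\<exists>j. \<exists>w\<in>chart j. residual j x f w \<in> vpow n)"
proof -
  have "w - axis j 1 \<in> vpow 0" if "w \<in> chart j" for w j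
    using that axis_chart chartD(1) by (intro vpow_diff) auto
  then show ?thesis using assms unfolding hits_mod_def hits_def by blast
qed

lemma hits_mod_cong:
  assumes "f \<in> lipschitz_maps v" "x \<in> vpow 0" "y \<in> vpow 0" "x - y \<in> vpow n" "f \<in> hits_mod x n"
  shows "f \<in> hits_mod y n"
proof -
  obtain j w where w: "w \<in> chart j" "residual j x f w \<in> vpow n"
    using assms by (auto simp: hits_mod_iff)
  have "residual j x f w - residual j y f w \<in> vpow n"
    using assms w by (intro residual_cong) auto
  then show ?thesis using w assms(1) vpow_cong hits_mod_iff by blast
qed

text \<open>\<open>can\<close> and a chart vector of the same line differ by a unit of the ring,
  which is absorbed into the parameter \<open>t\<close>.\<close>

lemma kakeya_set_eq_line_union:
  fixes f :: "('a, 'n) proj \<Rightarrow> 'a ^ 'n::{finite,linorder}"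
  assumes f: "f \<in> lipschitz_maps v"
  shows "kakeya_set v f = line_union f"
proof (rule set_eqI, rule iffI)
  fix x assume "x \<in> kakeya_set v f"
  then obtain a t where x: "x = t *s can v a + f a" "t \<in> mpow 0"
    by (auto simp: kakeya_set_def mpow_0)
  obtain j where j: "can v a \<in> chart j" using can_in_chart by blast
  have "dir (can v a) = a" using can_in_unit_reps by (rule unit_repsD(4))
  then have "residual j x f (can v a) = 0"
    using chartD(2)[OF j] by (simp add: residual_def x)
  moreover have "x \<in> vpow 0"
    using x vpow_add vpow_scale_int chartD(1)[OF j] lipschitz_integral[OF f] by blast
  ultimately show "x \<in> line_union f" using j by (auto simp: line_union_def)
next
  fix x assume "x \<in> line_union f"
  then obtain j w where x: "x \<in> vpow 0" and w: "w \<in> chart j" "residual j x f w = 0"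
    by (auto simp: line_union_def)
  obtain c where c: "can v (dir w) = c *s w" "val_norm v c = 1"
    using unit_reps_scale[OF chart_unit_reps[OF w(1)] can_in_unit_reps] .
  let ?t = "(x - f (dir w)) $ j"
  have t: "?t \<in> mpow 0" using x lipschitz_integral[OF f] by (intro vpowD vpow_diff)
  have "inverse c \<in> mpow 0" "c \<noteq> 0"
    using unit_inverse val_norm_eq_1D[OF c(2)] by auto
  moreover have "x = (?t * inverse c) *s can v (dir w) + f (dir w)"
  proof -
    have "(?t * inverse c) *s can v (dir w) = (?t * (inverse c * c)) *s w"
      by (simp only: c(1) vector_smult_assoc mult.assoc)
    also have "\<dots> = ?t *s w"
      using \<open>c \<noteq> 0\<close> by simp
    also have "\<dots> = x - f (dir w)"
      using w(2) unfolding residual_def by (simp only: right_minus_eq)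
    finally show ?thesis by (simp only: diff_add_cancel)
  qed
  ultimately have "\<exists>t. x = t *s can v (dir w) + f (dir w) \<and> t \<in> mpow 0"
    using t mpow_mult_int by blast
  then show "x \<in> kakeya_set v f" unfolding kakeya_set_def mpow_0 by blast
qed

lemma line_union_hits_mod: "f \<in> lipschitz_maps v \<Longrightarrow> x \<in> line_union f \<Longrightarrow> f \<in> hits_mod x n"
  by (force simp: line_union_def hits_mod_iff)

text \<open>
  Koenig's lemma: a chart point is approximated by successive subdivision, keeping a cell that
  contains solutions modulo every power of the maximal ideal.
\<close>

lemma line_union_if_hits_mod:
  fixes f :: "('a, 'n::finite) proj \<Rightarrow> 'a ^ 'n"
  assumes f: "f \<in> lipschitz_maps v" and x: "x \<in> vpow 0" and hits: "\<And>n. f \<in> hits_mod x n"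
  shows "x \<in> line_union f"
proof -
  define good where "good j u m \<longleftrightarrow> (\<forall>n. f \<in> hits j x u m n)" for j u m
  \<comment> \<open>\<open>hits\<close> shrinks as the exponent grows: if each of finitely many
    cells failed at some exponent, all would fail at the largest of these.\<close>
  have pigeonhole: "\<exists>i\<in>I. \<forall>n. f \<in> hits (J i) x (U i) m n"
    if I: "finite I" "\<And>n. \<exists>i\<in>I. f \<in> hits (J i) x (U i) m n"
    for I :: "'i set" and J U m
  proof (rule ccontr)
    assume "\<not> ?thesis"
    then obtain N where N: "\<And>i. i \<in> I \<Longrightarrow> f \<notin> hits (J i) x (U i) m (N i)" by metis
    obtain i where i: "i \<in> I" "f \<in> hits (J i) x (U i) m (Max (N ` I))" using I(2) by blast
    have "N i \<le> Max (N ` I)" using i I(1) by simp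
    then show False using hits_antimono N i by blast
  qed
  obtain j where j: "good j (axis j 1) 0"
    using pigeonhole[of UNIV "\<lambda>j. j" "\<lambda>j. axis j 1" 0] hits
    by (auto simp: good_def hits_mod_def)
  have step: "\<exists>c\<in>chart_reps j. good j (subcell u m c) (Suc m)" if u: "u \<in> chart j" "good j u m" for u m
    unfolding good_def
  proof (rule pigeonhole[OF chart_reps_finite])
    fix n
    obtain w where w: "w \<in> chart j" "w - u \<in> vpow m" "residual j x f w \<in> vpow n"
      using u by (auto simp: good_def hits_def)
    obtain c where "c \<in> chart_reps j" "w - subcell u m c \<in> vpow (Suc m)"
      using subcell_cover[OF u(1) w(1,2)] .
    then show "\<exists>c\<in>chart_reps j. f \<in> hits j x (subcell u m c) (Suc m) n"
      using w f by (auto simp: hits_def)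
  qed
  have "\<exists>s. \<forall>n. (s n \<in> chart j \<and> good j (s n) n) \<and> s (Suc n) - s n \<in> vpow n"
  proof (rule dependent_nat_choice)
    show "\<exists>u. u \<in> chart j \<and> good j u 0" using j axis_chart by blast
  next
    fix u n assume "u \<in> chart j \<and> good j u n"
    then show "\<exists>y. (y \<in> chart j \<and> good j y (Suc n)) \<and> y - u \<in> vpow n"
      using step[of u n] subcell_chart subcell_cong by blast
  qed
  then obtain s where s: "\<And>n. s n \<in> chart j" "\<And>n. good j (s n) n" "\<And>n. s (Suc n) - s n \<in> vpow n"
    by blast
  obtain l where l: "\<And>n. l - s n \<in> vpow n" using vpow_limit[OF s(3)] by blast
  have "l $ j - 1 \<in> mpow n" for n
    using vpowD[OF l, of n j] chartD(2)[OF s(1)] by simp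
  then have "l $ j = 1" using mpow_Inter[of "l $ j - 1"] by simp
  moreover have "l \<in> vpow 0" using l[of 0] vpow_cong chartD(1)[OF s(1)] by blast
  ultimately have lj: "l \<in> chart j" by (simp add: chart_def)
  \<comment> \<open>A solution modulo \<open>vpow n\<close> in the \<open>n\<close>-th cell is
    congruent to \<open>l\<close>, and residuals respect this congruence.\<close>
  have "residual j x f l \<in> vpow n" for n
  proof -
    obtain w where w: "w \<in> chart j" "w - s n \<in> vpow n" "residual j x f w \<in> vpow n"
      using s(2)[of n] by (auto simp: good_def hits_def)
    have "w - l \<in> vpow n" using w(2) l[of n] vpow_sub_comm vpow_cong_trans by blast
    then have "residual j x f w - residual j x f l \<in> vpow n"
      using x f w lj by (intro residual_cong) (auto intro: lipschitz_cong)
    with w(3) show ?thesis using vpow_cong by blast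
  qed
  then have "residual j x f l = 0" by (rule vpow_Inter)
  then show ?thesis using x lj by (auto simp: line_union_def)
qed

text \<open>By the Koenig argument an integral point off the set is excluded modulo some power, and
  then so is its coset. The set is thus closed, hence Borel, as membership in
  \<open>null_sets\<close> demands.\<close>

lemma openin_Compl_line_union:
  assumes f: "f \<in> lipschitz_maps v"
  shows "openin (vec_topology v) (- line_union f)"
proof (rule openin_vec_topologyI)
  fix x assume x: "x \<in> - line_union f"
  show "\<exists>n. {y. y - x \<in> vpow n} \<subseteq> - line_union f"
  proof (cases "x \<in> vpow 0")
    case False
    have "{y. y - x \<in> vpow 0} \<subseteq> - line_union f"
      using False vpow_cong by (auto simp: line_union_def)
    then show ?thesis by blast
  next
    case True
    then obtain n where n: "f \<notin> hits_mod x n" using x f line_union_if_hits_mod by blast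
    have "y \<notin> line_union f" if "y - x \<in> vpow n" for y
    proof
      assume y: "y \<in> line_union f"
      then have "f \<in> hits_mod x n"
        using hits_mod_cong[OF f _ True that] line_union_hits_mod[OF f y] by (auto simp: line_union_def)
      with n show False by blast
    qed
    then show ?thesis by blast
  qed
qed

end

section \<open>Critical branching\<close>

text \<open>
  The probability that a Galton--Watson process with offspring distribution
  \<open>Bin(Q, 1/Q)\<close> survives for \<open>n\<close> generations.
\<close>

fun survival :: "nat \<Rightarrow> nat \<Rightarrow> real" where
  "survival Q 0 = 1"
| "survival Q (Suc n) = 1 - (1 - survival Q n / Q) ^ Q"

lemma survival_bounds:
  assumes "1 \<le> Q"
  shows "0 \<le> survival Q n \<and> survival Q n \<le> 1"
proof (induction n)
  case (Suc n)
  then have "survival Q n / Q \<le> 1" using assms by (simp add: divide_le_eq)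
  with Suc have "0 \<le> (1 - survival Q n / Q) ^ Q" "(1 - survival Q n / Q) ^ Q \<le> 1"
    by (auto intro!: power_le_one)
  then show ?case by simp
qed simp

text \<open>Bernoulli's inequality sharpened by a square, with equality for \<open>Q = 2\<close>.
  The square forces extinction, since the linear term cancels at criticality.\<close>

lemma one_minus_power_ge:
  fixes y :: real
  assumes "0 \<le> y" "y \<le> 1" "2 \<le> Q"
  shows "1 - real Q * y + y\<^sup>2 \<le> (1 - y) ^ Q"
  using assms(3)
proof (induction Q rule: dec_induct)
  case base
  show ?case by (simp add: power2_eq_square algebra_simps)
next
  case (step Q)
  \<comment> \<open>Expanding the product in the next inequality leaves the surplus
    \<open>Q * y\<^sup>2 - y ^ 3\<close>.\<close>
  have "y * y\<^sup>2 \<le> real Q * y\<^sup>2"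
    using assms step(1) by (intro mult_right_mono) auto
  then have "1 - real (Suc Q) * y + y\<^sup>2 \<le> (1 - y) * (1 - real Q * y + y\<^sup>2)"
    by (simp add: power2_eq_square algebra_simps)
  also have "\<dots> \<le> (1 - y) * (1 - y) ^ Q"
    using step assms by (intro mult_left_mono) auto
  finally show ?case by simp
qed

text \<open>Each generation loses at least the square of \<open>survival Q n / Q\<close>. The
  sequence decreases, and its limit satisfies \<open>L \<le> L - (L / Q)\<^sup>2\<close>.\<close>

lemma survival_tendsto_0:
  assumes "2 \<le> Q"
  shows "survival Q \<longlonglongrightarrow> 0"
proof -
  have b: "0 \<le> survival Q n" "survival Q n \<le> 1" for n
    using survival_bounds[of Q n] assms by auto
  have step: "survival Q (Suc n) \<le> survival Q n - (survival Q n / Q)\<^sup>2" for n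
  proof -
    have "survival Q n / Q \<le> 1" using b[of n] assms by (simp add: divide_le_eq)
    then show ?thesis
      using one_minus_power_ge[of "survival Q n / Q" Q] b[of n] assms by simp
  qed
  then have "survival Q (Suc n) \<le> survival Q n" for n
    using zero_le_power2[of "survival Q n / Q"] by (meson add_increasing2 diff_le_eq order_trans order_refl)
  then have "decseq (survival Q)" by (rule decseq_SucI)
  then obtain L where L: "survival Q \<longlonglongrightarrow> L" and "\<And>i. L \<le> survival Q i"
    using decseq_convergent[of "survival Q" 0] b by blast
  have "L \<le> L - (L / Q)\<^sup>2"
  proof (rule LIMSEQ_le[OF LIMSEQ_Suc[OF L]])
    show "(\<lambda>n. survival Q n - (survival Q n / Q)\<^sup>2) \<longlonglongrightarrow> L - (L / Q)\<^sup>2"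
      using assms by (intro tendsto_intros L) auto
  qed (use step in blast)
  then have "L = 0" using assms by simp
  with L show ?thesis by simp
qed

section \<open>Random Lipschitz maps\<close>

locale random_lipschitz_map = complete_discretely_valued_field v
  for v :: "'a::field \<Rightarrow> int" +
  fixes \<nu> :: "(('a, 'n::finite) proj \<Rightarrow> 'a ^ 'n) measure"
  assumes haar: "haar_measure (lipschitz_topology v) \<nu>"
    and total: "emeasure \<nu> (lipschitz_maps v) = 1"
begin

lemma topspace_lipschitz: "topspace (lipschitz_topology v) = lipschitz_maps v"
  unfolding lipschitz_topology_def
  using Metric_space.topspace_mtopology[OF Metric_space_uniform_dist] by blast

lemma space_nu: "space \<nu> = lipschitz_maps v"
  using haar by (simp add: haar_measure_def topspace_lipschitz)

lemma open_sets_nu: "openin (lipschitz_topology v) S \<Longrightarrow> S \<in> sets \<nu>"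
  using haar by (simp add: haar_measure_def sigma_sets.Basic)

lemma emeasure_translate:
  "h \<in> lipschitz_maps v \<Longrightarrow> A \<in> sets \<nu> \<Longrightarrow> emeasure \<nu> ((+) h ` A) = emeasure \<nu> A"
  using haar by (simp add: haar_measure_def topspace_lipschitz)

sublocale prob_nu: finite_measure \<nu>
  by standard (simp add: space_nu total)

lemma measure_total: "measure \<nu> (lipschitz_maps v) = 1"
  by (simp add: measure_def total)

lemma sets_nuD: "A \<in> sets \<nu> \<Longrightarrow> f \<in> A \<Longrightarrow> f \<in> lipschitz_maps v"
  using sets.sets_into_space space_nu by blast

section \<open>Measurable events\<close>

lemma hits_sets:
  assumes "x \<in> vpow 0"
  shows "hits j x u m n \<in> sets \<nu>"
proof (rule open_sets_nu, rule openin_lipschitz_topologyI)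
  fix f g assume "f \<in> hits j x u m n" "g \<in> lipschitz_maps v" "\<And>a. g a - f a \<in> vpow n"
  then show "g \<in> hits j x u m n"
    using hits_cong[OF assms] vpow_sub_comm by blast
qed (auto simp: hits_def)

lemma residual_sets:
  assumes "x \<in> vpow 0" "u \<in> chart j"
  shows "{f \<in> lipschitz_maps v. residual j x f u + c \<in> vpow n} \<in> sets \<nu>"
proof (rule open_sets_nu, rule openin_lipschitz_topologyI)
  fix f g assume f: "f \<in> {f \<in> lipschitz_maps v. residual j x f u + c \<in> vpow n}"
    and g: "g \<in> lipschitz_maps v" "\<And>a. g a - f a \<in> vpow n"
  have "residual j x g u - residual j x f u \<in> vpow n"
    using f g assms by (intro residual_cong) auto
  from vpow_add[OF this, of "residual j x f u + c"] f
  show "g \<in> {f \<in> lipschitz_maps v. residual j x f u + c \<in> vpow n}"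
    using g by simp
qed auto

text \<open>Expresses that \<open>A\<close> does not see changes of \<open>f\<close> on the cell of
  level \<open>n\<close> that are divisible by \<open>unif ^ m\<close>. Since \<open>- h\<close> is
  admissible along with \<open>h\<close>, this is stability in both directions.\<close>

definition invariant :: "'n \<Rightarrow> 'a ^ 'n \<Rightarrow> nat \<Rightarrow> nat \<Rightarrow> (('a, 'n) proj \<Rightarrow> 'a ^ 'n) set \<Rightarrow> bool" where
  "invariant j u n m A \<longleftrightarrow> (\<forall>f\<in>A. \<forall>h\<in>lipschitz_maps v.
     (\<forall>a. a \<notin> cell j u n \<longrightarrow> h a = 0) \<longrightarrow> (\<forall>a. h a \<in> vpow m) \<longrightarrow> f + h \<in> A)"

lemma invariantD:
  assumes "invariant j u n m A" "f \<in> A" "h \<in> lipschitz_maps v"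
    and "\<And>a. a \<notin> cell j u n \<Longrightarrow> h a = 0" "\<And>a. h a \<in> vpow m"
  shows "f + h \<in> A"
  using assms by (simp add: invariant_def)

text \<open>
  Translating by the bump functions with values \<open>\<pi>\<^sup>m c\<close>, for \<open>c\<close> in \<open>chart_reps j\<close>, maps the
  event to pairwise disjoint subsets of \<open>A\<close>.
\<close>

lemma measure_hits_one_level:
  assumes x: "x \<in> vpow 0" and u: "u \<in> chart j" and A: "A \<in> sets \<nu>" and inv: "invariant j u (Suc m) m A"
  shows "card (chart_reps j) * measure \<nu> (A \<inter> hits j x u (Suc m) (Suc m)) \<le> measure \<nu> A"
proof -
  let ?B = "A \<inter> hits j x u (Suc m) (Suc m)"
  define T where "T c = {f \<in> A. residual j x f u + unif ^ m *s c \<in> vpow (Suc m)}" for c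
  define h where "h c a = (if a \<in> cell j u (Suc m) then unif ^ m *s c else 0)" for c :: "'a ^ 'n" and a :: "('a, 'n) proj"
  have T_sets: "T c \<in> sets \<nu>" for c
  proof -
    have "T c = A \<inter> {f \<in> lipschitz_maps v. residual j x f u + unif ^ m *s c \<in> vpow (Suc m)}"
      using sets_nuD[OF A] by (auto simp: T_def)
    then show ?thesis using A residual_sets[OF x u] by simp
  qed
  have B: "?B = {f \<in> A. residual j x f u \<in> vpow (Suc m)}"
    using sets_nuD[OF A] by (auto simp: hits_diagonal[OF x u])
  have hits_B: "?B \<in> sets \<nu>" using A hits_sets[OF x] by blast
  have u_cell: "dir u \<in> cell j u (Suc m)" using u by (simp add: dir_in_cell_iff)
  have T_eq: "(+) (h c) ` ?B = T c" if c: "c \<in> chart_reps j" for c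
  proof -
    have hc: "h c \<in> lipschitz_maps v"
      unfolding h_def by (intro bump_lipschitz unif_power_vpow chart_reps_integral[OF c])
    have h_vpow: "h c a \<in> vpow m" for a
      by (simp add: h_def unif_power_vpow chart_reps_integral[OF c])
    have hu: "h c (dir u) = unif ^ m *s c" using u_cell by (simp add: h_def)
    \<comment> \<open>With coordinate \<open>j\<close> equal to 0, the bump shifts the residual and
      leaves the coefficient of \<open>u\<close> alone.\<close>
    then have huj: "h c (dir u) $ j = 0" using c by (simp add: chart_reps_def)
    have res: "residual j x (f + h c) u = residual j x f u - unif ^ m *s c"
      and res': "residual j x (f + - h c) u = residual j x f u + unif ^ m *s c" for f
      using residual_add[of "h c" u j x f] residual_add[of "- h c" u j x f] hu huj by simp_all
    show ?thesis
    proof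
      show "(+) (h c) ` ?B \<subseteq> T c"
      proof
        fix g assume "g \<in> (+) (h c) ` ?B"
        then obtain f where f: "f \<in> ?B" "g = f + h c" by (auto simp: add.commute)
        then have "g \<in> A" using invariantD[OF inv, of f "h c"] hc h_vpow by (auto simp: h_def)
        moreover have "residual j x g u + unif ^ m *s c \<in> vpow (Suc m)"
          using f B by (simp add: res)
        ultimately show "g \<in> T c" by (simp add: T_def)
      qed
      show "T c \<subseteq> (+) (h c) ` ?B"
      proof
        fix g assume g: "g \<in> T c"
        then have "g + - h c \<in> A"
          using invariantD[OF inv, of g "- h c"] lipschitz_minus[OF hc] vpow_minus[OF h_vpow]
          by (auto simp: T_def h_def)
        moreover have "residual j x (g + - h c) u \<in> vpow (Suc m)"
          using g by (simp only: res') (simp add: T_def)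
        ultimately have "g + - h c \<in> ?B" by (simp add: B)
        then show "g \<in> (+) (h c) ` ?B" by (rule image_eqI[rotated]) simp
      qed
    qed
  qed
  have T_measure: "measure \<nu> (T c) = measure \<nu> ?B" if c: "c \<in> chart_reps j" for c
  proof -
    have "h c \<in> lipschitz_maps v"
      unfolding h_def by (intro bump_lipschitz unif_power_vpow chart_reps_integral[OF c])
    then have "emeasure \<nu> (T c) = emeasure \<nu> ?B"
      using emeasure_translate[OF _ hits_B] T_eq[OF c] by metis
    then show ?thesis by (simp add: measure_def)
  qed
  have disj: "disjoint_family_on T (chart_reps j)"
    unfolding disjoint_family_on_def
  proof (intro ballI impI)
    fix c c' assume c: "c \<in> chart_reps j" "c' \<in> chart_reps j" "c \<noteq> c'"
    have False if "f \<in> T c" "f \<in> T c'" for f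
    proof -
      have "(residual j x f u + unif ^ m *s c) - (residual j x f u + unif ^ m *s c') \<in> vpow (Suc m)"
        using that by (intro vpow_diff) (auto simp: T_def)
      \<comment> \<open>The digits in their second reading: what separates the centres of subcells
        also separates residuals.\<close>
      then have "subcell u m c - subcell u m c' \<in> vpow (Suc m)" by (simp add: subcell_def)
      then show False using subcell_unique c by blast
    qed
    then show "T c \<inter> T c' = {}" by blast
  qed
  have "card (chart_reps j) * measure \<nu> ?B = (\<Sum>c\<in>chart_reps j. measure \<nu> (T c))"
    by (simp add: T_measure)
  also have "\<dots> = measure \<nu> (\<Union>c\<in>chart_reps j. T c)"
    by (intro prob_nu.finite_measure_finite_Union[symmetric] chart_reps_finite disj) (use T_sets in auto)
  also have "\<dots> \<le> measure \<nu> A"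
    by (intro prob_nu.finite_measure_mono A) (auto simp: T_def)
  finally show ?thesis .
qed

text \<open>
  The invariance of \<open>A\<close> replaces independence: it makes the bound a conditional one, which is
  applied to the subcells one after the other, conditioning each time on the failure of the
  previous ones.
\<close>

lemma measure_hits_le:
  fixes j :: 'n
  defines "Q \<equiv> card (chart_reps j :: ('a ^ 'n) set)"
  assumes x: "x \<in> vpow 0" and Q: "1 \<le> Q"
  shows "u \<in> chart j \<Longrightarrow> A \<in> sets \<nu> \<Longrightarrow> invariant j u m m A \<Longrightarrow>
    measure \<nu> (A \<inter> hits j x u m (m + r)) \<le> survival Q r * measure \<nu> A"
proof (induction r arbitrary: u m A)
  case 0
  then show ?case by (auto intro: prob_nu.finite_measure_mono)
next
  case (Suc r)
  let ?C = "chart_reps j :: ('a ^ 'n) set"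
  let ?E = "\<lambda>c. hits j x (subcell u m c) (Suc m) (m + Suc r)"
  let ?y = "survival Q r / Q"
  \<comment> \<open>The part of \<open>A\<close> where every child in \<open>S\<close> has failed;
    this is the event conditioned on.\<close>
  define D where "D S = A - (\<Union>c\<in>S. ?E c)" for S
  have D_sets: "D S \<in> sets \<nu>" if "finite S" for S
    unfolding D_def using that Suc.prems(2) hits_sets[OF x] by (intro sets.Diff sets.finite_UN) auto
  have y: "0 \<le> survival Q r" "?y \<le> 1"
    using survival_bounds[OF Q, of r] Q by (auto simp: divide_le_eq)
  \<comment> \<open>A change on child \<open>c\<close> lies inside the parent, so it preserves
    \<open>A\<close>; it vanishes on the cells of \<open>S\<close>, so it cannot revive a failed
    child.\<close>
  have D_inv: "invariant j (subcell u m c) (Suc m) m (D S)" if c: "c \<in> ?C" "S \<subseteq> ?C" "c \<notin> S" for c S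
    unfolding invariant_def
  proof (intro ballI impI)
    fix f h assume f: "f \<in> D S" and h: "h \<in> lipschitz_maps v"
      "\<forall>a. a \<notin> cell j (subcell u m c) (Suc m) \<longrightarrow> h a = 0" "\<forall>a. h a \<in> vpow m"
    have fL: "f \<in> lipschitz_maps v" using f sets_nuD[OF Suc.prems(2)] by (auto simp: D_def)
    have "cell j (subcell u m c) (Suc m) \<subseteq> cell j u m"
      using c by (intro cell_mono subcell_cong) auto
    then have "f + h \<in> A"
      using f h by (intro invariantD[OF Suc.prems(3)]) (auto simp: D_def)
    moreover have "f + h \<notin> ?E c'" if c': "c' \<in> S" for c'
    proof
      assume fh: "f + h \<in> ?E c'"
      have "f \<in> ?E c'"
      proof (rule hits_cong[OF x fh fL])
        fix w assume w: "w \<in> chart j" "w - subcell u m c' \<in> vpow (Suc m)"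
        have "dir w \<notin> cell j (subcell u m c) (Suc m)"
        proof
          assume "dir w \<in> cell j (subcell u m c) (Suc m)"
          then have "w - subcell u m c \<in> vpow (Suc m)" using w by (simp add: dir_in_cell_iff)
          then have "subcell u m c - subcell u m c' \<in> vpow (Suc m)"
            using w vpow_sub_comm vpow_cong_trans by blast
          then have "c = c'" using c c' subcell_unique by blast
          with c c' show False by blast
        qed
        then show "(f + h) (dir w) - f (dir w) \<in> vpow (m + Suc r)" using h by (simp add: plus_fun_def)
      qed
      then show False using f c' by (auto simp: D_def)
    qed
    ultimately show "f + h \<in> D S" by (auto simp: D_def)
  qed
  have step: "measure \<nu> (D S \<inter> ?E c) \<le> ?y * measure \<nu> (D S)"
    if c: "c \<in> ?C" "S \<subseteq> ?C" "c \<notin> S" for c S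
  proof -
    let ?u = "subcell u m c"
    let ?E1 = "hits j x ?u (Suc m) (Suc m)"
    have u: "?u \<in> chart j" using Suc.prems(1) c by (intro subcell_chart)
    have DS: "D S \<in> sets \<nu>" using D_sets chart_reps_finite finite_subset c by blast
    \<comment> \<open>Fixing the residual of the child modulo \<open>vpow (Suc m)\<close> uses up
      one level of freedom; what remains is the invariance that the induction hypothesis at
      \<open>Suc m\<close> requires.\<close>
    have inv: "invariant j ?u (Suc m) (Suc m) (D S \<inter> ?E1)"
      unfolding invariant_def
    proof (intro ballI impI)
      fix f h assume f: "f \<in> D S \<inter> ?E1" and h: "h \<in> lipschitz_maps v"
        "\<forall>a. a \<notin> cell j ?u (Suc m) \<longrightarrow> h a = 0" "\<forall>a. h a \<in> vpow (Suc m)"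
      have fL: "f \<in> lipschitz_maps v" using f by (simp add: hits_def)
      have "h a \<in> vpow m" for a using h(3) vpow_antimono[of m "Suc m" "h a"] by simp
      then have "f + h \<in> D S" using f h by (intro invariantD[OF D_inv[OF c]]) auto
      moreover have "f + h \<in> ?E1"
      proof (rule hits_cong[OF x])
        show "f \<in> ?E1" using f by blast
        show "f + h \<in> lipschitz_maps v" using fL h(1) by (rule lipschitz_add)
        show "f (dir w) - (f + h) (dir w) \<in> vpow (Suc m)" for w
          using h(3) by (simp add: plus_fun_def vpow_minus)
      qed
      ultimately show "f + h \<in> D S \<inter> ?E1" by blast
    qed
    \<comment> \<open>Survival to level \<open>m + Suc r\<close> includes survival to
      \<open>Suc m\<close>, from where \<open>r\<close> generations remain.\<close>
    have "?E c \<subseteq> ?E1" by (rule hits_antimono) simp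
    then have "D S \<inter> ?E c = (D S \<inter> ?E1) \<inter> hits j x ?u (Suc m) (Suc m + r)" by auto
    then have "measure \<nu> (D S \<inter> ?E c) \<le> survival Q r * measure \<nu> (D S \<inter> ?E1)"
      using Suc.IH[OF u _ inv] DS hits_sets[OF x] by auto
    also have "\<dots> \<le> survival Q r * (measure \<nu> (D S) / Q)"
    proof (rule mult_left_mono[OF _ y(1)])
      have "Q * measure \<nu> (D S \<inter> ?E1) \<le> measure \<nu> (D S)"
        unfolding Q_def by (rule measure_hits_one_level[OF x u DS D_inv[OF c]])
      then show "measure \<nu> (D S \<inter> ?E1) \<le> measure \<nu> (D S) / Q"
        using Q by (simp add: pos_le_divide_eq mult.commute)
    qed
    finally show ?thesis by simp
  qed
  \<comment> \<open>Children are exposed one at a time, each leaving at least the fraction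
    \<open>1 - ?y\<close> of what was left before.\<close>
  have D_ge: "(1 - ?y) ^ card S * measure \<nu> A \<le> measure \<nu> (D S)" if "S \<subseteq> ?C" for S
    using finite_subset[OF that chart_reps_finite] that
  proof (induction S rule: finite_induct)
    case empty
    then show ?case by (simp add: D_def)
  next
    case (insert c S)
    have DS: "D S \<in> sets \<nu>" using D_sets insert by simp
    have "D (insert c S) = D S - (D S \<inter> ?E c)" by (auto simp: D_def)
    then have "measure \<nu> (D (insert c S)) = measure \<nu> (D S) - measure \<nu> (D S \<inter> ?E c)"
      using DS hits_sets[OF x] by (simp add: prob_nu.finite_measure_Diff)
    also have "\<dots> \<ge> (1 - ?y) * measure \<nu> (D S)"
      using step[of c S] insert by (simp add: left_diff_distrib)
    also have "(1 - ?y) * measure \<nu> (D S) \<ge> (1 - ?y) * ((1 - ?y) ^ card S * measure \<nu> A)"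
      using insert y by (intro mult_left_mono) auto
    finally show ?case using insert by simp
  qed
  have "A \<inter> hits j x u m (m + Suc r) \<subseteq> A - D ?C"
  proof
    fix f assume f: "f \<in> A \<inter> hits j x u m (m + Suc r)"
    then obtain w where w: "w \<in> chart j" "w - u \<in> vpow m" "residual j x f w \<in> vpow (m + Suc r)"
      by (auto simp: hits_def)
    obtain c where "c \<in> ?C" "w - subcell u m c \<in> vpow (Suc m)"
      using subcell_cover[OF Suc.prems(1) w(1,2)] .
    then show "f \<in> A - D ?C" using f w by (auto simp: D_def hits_def)
  qed
  then have "measure \<nu> (A \<inter> hits j x u m (m + Suc r)) \<le> measure \<nu> (A - D ?C)"
    using Suc.prems(2) D_sets[OF chart_reps_finite] by (intro prob_nu.finite_measure_mono) auto
  also have "\<dots> = measure \<nu> A - measure \<nu> (D ?C)"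
    using Suc.prems(2) D_sets[OF chart_reps_finite]
    by (intro prob_nu.finite_measure_Diff) (auto simp: D_def)
  also have "\<dots> \<le> survival Q (Suc r) * measure \<nu> A"
    using D_ge[of ?C] by (simp add: Q_def left_diff_distrib)
  finally show ?case .
qed

section \<open>From one chart to the whole set\<close>

lemma hits_mod_sets: "x \<in> vpow 0 \<Longrightarrow> hits_mod x n \<in> sets \<nu>"
  unfolding hits_mod_def by (intro sets.finite_UN hits_sets) auto

text \<open>The branching bound is used with the whole space as \<open>A\<close>, which is invariant
  because Lipschitz maps are closed under addition. The factor \<open>CARD('n)\<close> is the union
  bound over charts.\<close>

lemma measure_hits_mod_le:
  assumes x: "x \<in> vpow 0" and d: "2 \<le> CARD('n)"
  shows "measure \<nu> (hits_mod x n) \<le> CARD('n) * survival (card (residue_field v) ^ (CARD('n) - 1)) n"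
proof -
  let ?Q = "card (residue_field v) ^ (CARD('n) - 1)"
  have Q: "1 \<le> ?Q" using card_residue_field_ge_2 by simp
  have "measure \<nu> (hits j x (axis j 1) 0 n) \<le> survival ?Q n" for j
  proof -
    have "lipschitz_maps v \<in> sets \<nu>" using sets.top[of \<nu>] by (simp add: space_nu)
    moreover have "invariant j (axis j 1) 0 0 (lipschitz_maps v)"
      by (simp add: invariant_def lipschitz_add)
    ultimately have "measure \<nu> (lipschitz_maps v \<inter> hits j x (axis j 1) 0 (0 + n))
        \<le> survival ?Q n * measure \<nu> (lipschitz_maps v)"
      using measure_hits_le[OF x _ axis_chart, of j "lipschitz_maps v" 0 n] Q by (simp add: card_chart_reps)
    moreover have "lipschitz_maps v \<inter> hits j x (axis j 1) 0 n = hits j x (axis j 1) 0 n"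
      by (auto simp: hits_def)
    ultimately show ?thesis by (simp add: measure_total)
  qed
  then have "(\<Sum>j\<in>UNIV. measure \<nu> (hits j x (axis j 1) 0 n)) \<le> (\<Sum>j\<in>(UNIV :: 'n set). survival ?Q n)"
    by (intro sum_mono)
  moreover have "measure \<nu> (hits_mod x n) \<le> (\<Sum>j\<in>UNIV. measure \<nu> (hits j x (axis j 1) 0 n))"
    unfolding hits_mod_def
    by (intro prob_nu.finite_measure_subadditive_finite) (auto simp: hits_sets[OF x])
  ultimately show ?thesis by simp
qed

text \<open>At level \<open>n\<close>, Fubini is the exchange of an integral with a finite sum over
  cosets. Each \<open>g n\<close> majorizes the measure of \<open>line_union f\<close>, and the
  infimum over \<open>n\<close> is a measurable majorant with integral 0.\<close>

lemma AE_line_union_null: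
  fixes \<mu> :: "('a ^ 'n) measure"
  assumes d: "2 \<le> CARD('n)" and haar_mu: "haar_measure (vec_topology v) \<mu>"
    and mu_1: "emeasure \<mu> (integral_vectors v) = 1"
  shows "AE f in \<nu>. line_union f \<in> null_sets \<mu>"
proof -
  have space_mu: "space \<mu> = UNIV" and open_mu: "\<And>U. openin (vec_topology v) U \<Longrightarrow> U \<in> sets \<mu>"
    using haar_mu by (auto simp: haar_measure_def sigma_sets.Basic)
  have coset_sets: "{y. y - x \<in> vpow n} \<in> sets \<mu>" for x n
    by (rule open_mu[OF openin_vec_coset])
  have sets_line_union: "line_union f \<in> sets \<mu>" if "f \<in> lipschitz_maps v" for f
    using sets.compl_sets[OF open_mu[OF openin_Compl_line_union[OF that]]]
    by (simp add: space_mu Compl_eq_Diff_UNIV[symmetric])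
  let ?Q = "card (residue_field v) ^ (CARD('n) - 1)"
  \<comment> \<open>Here d \<ge> 2 enters: for d = 1 the number \<open>?Q\<close> would be 1, and
    the process would survive forever.\<close>
  have "2 ^ 1 \<le> ?Q"
    using card_residue_field_ge_2 d by (intro order_trans[OF power_increasing power_mono]) auto
  then have Q: "2 \<le> ?Q" by simp
  define P :: "nat \<Rightarrow> ('a ^ 'n) set set" where "P n = (\<lambda>x. {y. y - x \<in> vpow n}) ` vpow 0" for n
  define rep :: "('a ^ 'n) set \<Rightarrow> 'a ^ 'n" where "rep X = (SOME x. x \<in> X)" for X
  \<comment> \<open>The total mass of the cosets hit by \<open>f\<close> modulo
    \<open>vpow n\<close>; by \<open>hits_mod_cong\<close> any representative of a coset may be
    tested.\<close>
  define g where "g n f = (\<Sum>X\<in>P n. emeasure \<mu> X * indicator (hits_mod (rep X) n) f)" for n f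
  have P_eq: "X = {y. y - x \<in> vpow n}" if X: "X \<in> P n" "x \<in> X" for X x n
  proof -
    obtain z where z: "X = {y. y - z \<in> vpow n}" using X(1) by (auto simp: P_def)
    with X(2) have "x - z \<in> vpow n" by simp
    then show ?thesis unfolding z using vpow_cong_trans vpow_sub_comm by blast
  qed
  have finite_P: "finite (P n)" for n
  proof -
    obtain F :: "('a ^ 'n) set" where F: "finite F" "\<And>x. x \<in> vpow 0 \<Longrightarrow> \<exists>y\<in>F. x - y \<in> vpow n"
      using finite_vpow_reps[of n] by metis
    have "P n \<subseteq> (\<lambda>x. {y. y - x \<in> vpow n}) ` F"
    proof
      fix X assume X: "X \<in> P n"
      then obtain x where x: "x \<in> vpow 0" "X = {y. y - x \<in> vpow n}" by (auto simp: P_def)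
      obtain y where y: "y \<in> F" "x - y \<in> vpow n" using F(2)[OF x(1)] by blast
      then have "y \<in> X" using x by (simp add: vpow_sub_comm)
      then show "X \<in> (\<lambda>x. {y. y - x \<in> vpow n}) ` F" using P_eq[OF X] y by blast
    qed
    then show ?thesis using F(1) finite_surj by blast
  qed
  have P_sets: "X \<in> sets \<mu>" if "X \<in> P n" for X n
    using that coset_sets by (auto simp: P_def)
  have P_sub: "X \<subseteq> vpow 0" if "X \<in> P n" for X n
    using that vpow_antimono[of 0 n] vpow_cong[of _ _ 0] by (auto simp: P_def)
  have P_nonempty: "rep X \<in> X" if X: "X \<in> P n" for X n
  proof -
    obtain x where "X = {y. y - x \<in> vpow n}" using X by (auto simp: P_def)
    then have "x \<in> X" by simp
    then show ?thesis unfolding rep_def by (rule someI)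
  qed
  have rep: "rep X \<in> vpow 0" if "X \<in> P n" for X n
    using P_nonempty[OF that] P_sub[OF that] by blast
  have P_Union: "\<Union> (P n) = vpow 0" for n
  proof
    show "\<Union> (P n) \<subseteq> vpow 0" using P_sub by blast
    show "vpow 0 \<subseteq> \<Union> (P n)"
    proof
      fix x :: "'a ^ 'n" assume "x \<in> vpow 0"
      then have "{y. y - x \<in> vpow n} \<in> P n" unfolding P_def by (rule imageI)
      moreover have "x \<in> {y. y - x \<in> vpow n}" by simp
      ultimately show "x \<in> \<Union> (P n)" by (rule UnionI)
    qed
  qed
  have P_disj: "disjoint_family_on (\<lambda>X. X) (P n)" for n
    unfolding disjoint_family_on_def using P_eq by blast
  have g_meas: "g n \<in> borel_measurable \<nu>" for n
    unfolding g_def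
    by (intro borel_measurable_sum borel_measurable_times_ennreal borel_measurable_const
        borel_measurable_indicator hits_mod_sets rep)
  have mu_le: "emeasure \<mu> (line_union f) \<le> g n f" if f: "f \<in> lipschitz_maps v" for f n
  proof -
    let ?S = "{X \<in> P n. f \<in> hits_mod (rep X) n}"
    have "line_union f \<subseteq> \<Union> ?S"
    proof
      fix x assume x: "x \<in> line_union f"
      then have x0: "x \<in> vpow 0" by (simp add: line_union_def)
      then obtain X where X: "X \<in> P n" "x \<in> X" using P_Union by blast
      have "x - rep X \<in> vpow n"
        using P_nonempty[OF X(1)] P_eq[OF X] vpow_sub_comm by blast
      then have "f \<in> hits_mod (rep X) n"
        using hits_mod_cong[OF f x0 rep[OF X(1)]] line_union_hits_mod[OF f x] by blast
      with X show "x \<in> \<Union> ?S" by blast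
    qed
    then have "emeasure \<mu> (line_union f) \<le> emeasure \<mu> (\<Union>X\<in>?S. X)"
      using P_sets finite_P by (intro emeasure_mono) auto
    also have "\<dots> \<le> (\<Sum>X\<in>?S. emeasure \<mu> X)"
      using P_sets finite_P by (intro emeasure_subadditive_finite) auto
    also have "\<dots> = g n f"
      unfolding g_def using finite_P by (intro sum.mono_neutral_cong_left) (auto simp: indicator_def)
    finally show ?thesis .
  qed
  have int_g: "(\<integral>\<^sup>+ f. g n f \<partial>\<nu>) \<le> ennreal (CARD('n) * survival ?Q n)" for n
  proof -
    have "(\<integral>\<^sup>+ f. g n f \<partial>\<nu>) = (\<Sum>X\<in>P n. emeasure \<mu> X * emeasure \<nu> (hits_mod (rep X) n))"
      unfolding g_def using hits_mod_sets rep
      by (simp add: nn_integral_sum nn_integral_cmult_indicator)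
    also have "\<dots> \<le> (\<Sum>X\<in>P n. emeasure \<mu> X * ennreal (CARD('n) * survival ?Q n))"
      using measure_hits_mod_le[OF rep d]
      by (intro sum_mono mult_left_mono) (auto simp: prob_nu.emeasure_eq_measure intro!: ennreal_leI)
    \<comment> \<open>The hitting bound is uniform in the coset, so it factors out and the masses of
      the cosets add up.\<close>
    also have "\<dots> = emeasure \<mu> (\<Union>X\<in>P n. X) * ennreal (CARD('n) * survival ?Q n)"
      using P_sets by (subst sum_emeasure[OF _ P_disj finite_P, symmetric]) (auto simp: sum_distrib_right)
    also have "\<dots> = ennreal (CARD('n) * survival ?Q n)"
      using P_Union mu_1 by (simp add: vpow_0)
    finally show ?thesis .
  qed
  have "(\<lambda>n. ennreal (CARD('n) * survival ?Q n)) \<longlonglongrightarrow> ennreal (real CARD('n) * 0)"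
    by (intro tendsto_ennrealI tendsto_intros survival_tendsto_0 Q)
  moreover have "(\<integral>\<^sup>+ f. (INF n. g n f) \<partial>\<nu>) \<le> ennreal (CARD('n) * survival ?Q n)" for n
    by (intro order_trans[OF _ int_g[of n]] nn_integral_mono INF_lower) auto
  ultimately have "(\<integral>\<^sup>+ f. (INF n. g n f) \<partial>\<nu>) \<le> 0"
    by (intro LIMSEQ_le_const[of _ 0]) auto
  then have "AE f in \<nu>. (INF n. g n f) = 0"
    using g_meas by (subst (asm) le_zero_eq, subst (asm) nn_integral_0_iff_AE) auto
  moreover have "AE f in \<nu>. f \<in> lipschitz_maps v"
    using AE_space[of \<nu>] by (simp add: space_nu)
  ultimately show ?thesis
  proof eventually_elim
    fix f assume "(INF n. g n f) = 0" and f: "f \<in> lipschitz_maps v"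
    moreover have "emeasure \<mu> (line_union f) \<le> (INF n. g n f)"
      by (intro INF_greatest mu_le f)
    ultimately show "line_union f \<in> null_sets \<mu>"
      using sets_line_union[OF f] by (intro null_setsI) auto
  qed
qed

end

theorem theorem1:
  fixes v :: "'a::field \<Rightarrow> int"
    and \<mu> :: "('a ^ 'n::{finite,linorder}) measure"
    and \<nu> :: "(('a, 'n) proj \<Rightarrow> 'a ^ 'n::{finite,linorder}) measure"
  assumes "complete_discretely_valued_field v"
    and "CARD('n) \<ge> 2"
    and "haar_measure (vec_topology v) \<mu>"
    and "emeasure \<mu> (integral_vectors v) = 1"
    and "haar_measure (lipschitz_topology v) \<nu>"
    and "emeasure \<nu> (lipschitz_maps v) = 1"
  shows "AE f in \<nu>. kakeya_set v f \<in> null_sets \<mu>"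
proof -
  interpret complete_discretely_valued_field v by fact
  interpret random_lipschitz_map v \<nu> by unfold_locales fact+
  have "AE f in \<nu>. line_union f \<in> null_sets \<mu>"
    using assms by (intro AE_line_union_null)
  moreover have "AE f in \<nu>. f \<in> lipschitz_maps v"
    using AE_space[of \<nu>] by (simp add: space_nu)
  ultimately show ?thesis
    by eventually_elim (simp add: kakeya_set_eq_line_union)
qed

end
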